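(* Suppose that the following (the nonnegativity conjecture of Fomin and Kirillov) holds: for every $n\ge 2$ and every $w\in S_n$, the element $\mathfrak S_w(\theta)\in FK_n$, obtained from the Schubert polynomial $\mathfrak S_w(x_1,\dots,x_n)$ by substituting $x_i\mapsto\theta_i$, where $\theta_1,\dots,\theta_n$ are the Dunkl elements of the Fomin--Kirillov algebra $FK_n$, can be written as a linear combination with nonnegative coefficients of noncommutative monomials $[i_1j_1][i_2j_2]\cdots[i_mj_m]$ with $i_a<j_a$ for all $a$. Then the Chern--Schwartz--MacPherson classes of Schubert cells in type $A$ flag varieties are nonnegative: for every $n\ge 2$ and all $w,v\in S_n$, the coefficient $c(w;v)$ in the expansion $c_{SM}(X(w)^\circ)=\sum_{v\in S_n}c(w;v)[X(v)]$ satisfies $c(w;v)\ge 0$.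
   Context: Fomin--Kirillov algebra: $FK_n$ is the associative unital algebra generated by $[ij]$, $1\le i<j\le n$, with the convention $[ji]=-[ij]$, subject to: $[ij]^2=0$; $[ij][kl]=[kl][ij]$ for distinct $i,j,k,l$; $[ij][jk]=[jk][ik]+[ik][ij]$ and $[jk][ij]=[ik][jk]+[ij][ik]$ for distinct $i,j,k$. The Dunkl elements are $\theta_i=\sum_{j\ne i}[ij]$, $1\le i\le n$; they commute pairwise, so polynomials can be evaluated at them. Schubert polynomials: $\mathfrak S_{w_0}=x_1^{n-1}x_2^{n-2}\cdots x_{n-1}$ for the longest element $w_0\in S_n$, and $\mathfrak S_{ws_k}=\partial_k\mathfrak S_w$ if $\ell(ws_k)<\ell(w)$, where $\partial_k f=(f-s_kf)/(x_k-x_{k+1})$, $s_k=(k\ k{+}1)$ and $\ell$ is the length function. CSM classes: let $X=SL_n(\mathbb C)/B$, with $B$ the upper triangular matrices, $X(w)^\circ=BwB/B$ (Schubert cell) and $X(w)=\overline{BwB/B}$ (Schubert variety). The classes $[X(w)]$, $w\in S_n$, form a basis of $H_*(X)$. The CSM class is $c_{SM}(X(w)^\circ)=c_*(\mathbb 1_{X(w)^\circ})\in H_*(X)$, where $c_*$ is MacPherson's natural transformation from constructible functions to homology. It is known (Aluffi--Mihalcea) that these classes are determined by $c_{SM}(X(e)^\circ)=[X(e)]$ and $T_k(c_{SM}(X(w)^\circ))=c_{SM}(X(ws_k)^\circ)$ for all $w\in S_n$, $1\le k\le n-1$, where $T_k=\partial_k-s_k$ on $H_*(X)$; here $\partial_k[X(w)]=[X(ws_k)]$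 if $\ell(ws_k)>\ell(w)$ and $0$ otherwise, $s_k=\mathrm{id}-c_1(\mathcal L_{\alpha_k})\partial_k$, and $c_1(\mathcal L_\lambda)\cdot[X(w)]=\sum_\beta\langle\lambda,\beta^\vee\rangle[X(ws_\beta)]$, summed over positive roots $\beta$ with $\ell(ws_\beta)=\ell(w)-1$. The simple roots are $\alpha_k=\varepsilon_k-\varepsilon_{k+1}$, and for $\beta=\varepsilon_a-\varepsilon_b$ with $a<b$, $s_\beta$ is the transposition $(a\ b)$. *)

theory Defs
  imports "HOL-Combinatorics.Permutations" "HOL-Library.Poly_Mapping" Complex_Main
begin

section \<open>Permutations\<close>

text \<open>
  An element of \<open>S\<^sub>n\<close> is a function \<open>w\<close> with \<open>w permutes {1..n}\<close>; the product \<open>w v\<close> is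
  \<open>w \<circ> v\<close>, so \<open>w \<circ> transpose a b\<close> exchanges the values of \<open>w\<close> in positions \<open>a\<close> and \<open>b\<close>.
\<close>

text \<open>The length function as number of inversions; fixed points outside \<open>{1..n}\<close> do not
  contribute.\<close>

definition perm_length :: "(nat \<Rightarrow> nat) \<Rightarrow> nat" where
  "perm_length w = card {(i, j). i < j \<and> w j < w i}"

definition longest_perm :: "nat \<Rightarrow> nat \<Rightarrow> nat" where
  "longest_perm n = (\<lambda>i. if i \<in> {1..n} then n + 1 - i else i)"


section \<open>Schubert polynomials\<close>

text \<open>Integer polynomials in \<open>x\<^sub>0, x\<^sub>1, \<dots>\<close>: finitely supported functions from exponent vectors
  to coefficients, with the convolution product.\<close>

type_synonym int_poly = "(nat \<Rightarrow>\<^sub>0 nat) \<Rightarrow>\<^sub>0 int"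

definition poly_var :: "nat \<Rightarrow> int_poly" where
  "poly_var i = Poly_Mapping.single (Poly_Mapping.single i 1) 1"

text \<open>The inner \<open>map_key\<close> exchanges the exponents of \<open>x\<^sub>k\<close> and \<open>x\<^sub>k\<^sub>+\<^sub>1\<close>.\<close>

definition swap_vars :: "nat \<Rightarrow> int_poly \<Rightarrow> int_poly" where
  "swap_vars k f =
     Poly_Mapping.map_key (Poly_Mapping.map_key (transpose k (Suc k))) f"

text \<open>The quotient \<open>(f - s\<^sub>k f) / (x\<^sub>k - x\<^sub>k\<^sub>+\<^sub>1)\<close>; it exists for every \<open>f\<close> and is unique because
  \<^typ>\<open>int_poly\<close> is an integral domain.\<close>

definition divided_difference :: "nat \<Rightarrow> int_poly \<Rightarrow> int_poly" where
  "divided_difference k f =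
     (THE g. g * (poly_var k - poly_var (Suc k)) = f - swap_vars k f)"

text \<open>\<open>schubert_poly n w p\<close> means that \<open>p\<close> is the Schubert polynomial of \<open>w \<in> S\<^sub>n\<close>. The recursion
  reaches the same \<open>w\<close> along several descending chains from the longest element; by the
  classical braid relations for divided differences they all give the same \<open>p\<close>.\<close>

inductive schubert_poly :: "nat \<Rightarrow> (nat \<Rightarrow> nat) \<Rightarrow> int_poly \<Rightarrow> bool" for n where
  longest: "schubert_poly n (longest_perm n) (\<Prod>i = 1..<n. poly_var i ^ (n - i))"
| descend: "schubert_poly n w p \<Longrightarrow> 1 \<le> k \<Longrightarrow> k < n \<Longrightarrow>
     perm_length (w \<circ> transpose k (Suc k)) < perm_length w \<Longrightarrow>
     schubert_poly n (w \<circ> transpose k (Suc k)) (divided_difference k p)"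


section \<open>The Fomin--Kirillov algebra\<close>

text \<open>Noncommutative monomials: words in letters \<open>(i, j)\<close>, under concatenation. The letter
  \<open>(i, j)\<close> with \<open>i < j\<close> stands for the generator \<open>[ij]\<close>.\<close>

datatype fk_word = FK_Word (letters: "(nat \<times> nat) list")

instantiation fk_word :: monoid_add
begin

definition zero_fk_word :: fk_word where
  "0 = FK_Word []"

definition plus_fk_word :: "fk_word \<Rightarrow> fk_word \<Rightarrow> fk_word" where
  "u + v = FK_Word (letters u @ letters v)"

instance
  by standard (simp_all add: zero_fk_word_def plus_fk_word_def)

end

text \<open>The monoid algebra of words over the reals, that is, the free associative unital algebra.
  The algebra on the generators with indices in \<open>{1..n}\<close> is the carrier \<open>fk_free n\<close>.\<close>

type_synonym fk_poly = "fk_word \<Rightarrow>\<^sub>0 real"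

definition fk_free :: "nat \<Rightarrow> fk_poly set" where
  "fk_free n = {x. \<forall>u \<in> Poly_Mapping.keys x.
                  set (letters u) \<subseteq> {(i, j). 1 \<le> i \<and> i < j \<and> j \<le> n}}"

text \<open>The generator \<open>[ij]\<close>, with \<open>[ji] = -[ij]\<close>; only used for \<open>i \<noteq> j\<close>.\<close>

definition fk_gen :: "nat \<Rightarrow> nat \<Rightarrow> fk_poly" where
  "fk_gen i j = (if i < j then Poly_Mapping.single (FK_Word [(i, j)]) 1
                 else - Poly_Mapping.single (FK_Word [(j, i)]) 1)"

inductive_set fk_relators :: "nat \<Rightarrow> fk_poly set" for n where
  square: "{i, j} \<subseteq> {1..n} \<Longrightarrow> distinct [i, j] \<Longrightarrow>
     fk_gen i j * fk_gen i j \<in> fk_relators n"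
| commute: "{i, j, k, l} \<subseteq> {1..n} \<Longrightarrow> distinct [i, j, k, l] \<Longrightarrow>
     fk_gen i j * fk_gen k l - fk_gen k l * fk_gen i j \<in> fk_relators n"
| triangle1: "{i, j, k} \<subseteq> {1..n} \<Longrightarrow> distinct [i, j, k] \<Longrightarrow>
     fk_gen i j * fk_gen j k - (fk_gen j k * fk_gen i k + fk_gen i k * fk_gen i j)
       \<in> fk_relators n"
| triangle2: "{i, j, k} \<subseteq> {1..n} \<Longrightarrow> distinct [i, j, k] \<Longrightarrow>
     fk_gen j k * fk_gen i j - (fk_gen i k * fk_gen j k + fk_gen i j * fk_gen i k)
       \<in> fk_relators n"

text \<open>The two-sided ideal of \<open>fk_free n\<close> generated by the relators. \<open>FK\<^sub>n\<close> is the quotient of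
  \<open>fk_free n\<close> by it; its elements are represented by elements of \<open>fk_free n\<close>, and equality in
  \<open>FK\<^sub>n\<close> is \<open>fk_eq n\<close>.\<close>

inductive_set fk_ideal :: "nat \<Rightarrow> fk_poly set" for n where
  zero: "0 \<in> fk_ideal n"
| add: "x \<in> fk_ideal n \<Longrightarrow> r \<in> fk_relators n \<Longrightarrow> a \<in> fk_free n \<Longrightarrow> b \<in> fk_free n \<Longrightarrow>
     x + a * r * b \<in> fk_ideal n"

definition fk_eq :: "nat \<Rightarrow> fk_poly \<Rightarrow> fk_poly \<Rightarrow> bool" where
  "fk_eq n x y \<longleftrightarrow> x - y \<in> fk_ideal n"

definition dunkl :: "nat \<Rightarrow> nat \<Rightarrow> fk_poly" where
  "dunkl n i = (\<Sum>j \<in> {1..n} - {i}. fk_gen i j)"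

text \<open>A representative of \<open>p(\<theta>\<^sub>1, \<dots>, \<theta>\<^sub>n)\<close> for \<open>p\<close> in the variables \<open>x\<^sub>1, \<dots>, x\<^sub>n\<close>. The factors of
  each monomial are taken in increasing order of the index; as the Dunkl elements commute in
  \<open>FK\<^sub>n\<close>, the order does not affect the class.\<close>

definition eval_dunkl :: "nat \<Rightarrow> int_poly \<Rightarrow> fk_poly" where
  "eval_dunkl n p = (\<Sum>m \<in> Poly_Mapping.keys p.
     of_int (Poly_Mapping.lookup p m) *
     prod_list (map (\<lambda>i. dunkl n i ^ Poly_Mapping.lookup m i) [1..<Suc n]))"

definition fk_nonneg :: "nat \<Rightarrow> fk_poly \<Rightarrow> bool" where
  "fk_nonneg n x \<longleftrightarrow>
     (\<exists>y \<in> fk_free n. (\<forall>u. 0 \<le> Poly_Mapping.lookup y u) \<and> fk_eq n x y)"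


section \<open>Homology of the flag variety and CSM classes\<close>

text \<open>\<open>H\<^sub>*(X)\<close> is the free abelian group on the Schubert classes \<open>[X(w)]\<close>, \<open>w \<in> S\<^sub>n\<close>, with
  \<open>[X(w)] = frag_of w\<close>; the coefficient of \<open>[X(v)]\<close> in \<open>x\<close> is
  \<open>Poly_Mapping.lookup x v\<close>. The operators are given on the basis and extended linearly by \<^const>\<open>frag_extend\<close>.\<close>

type_synonym flag_homology = "(nat \<Rightarrow> nat) \<Rightarrow>\<^sub>0 int"

definition homology_partial :: "nat \<Rightarrow> flag_homology \<Rightarrow> flag_homology" where
  "homology_partial k = frag_extend (\<lambda>w.
     if perm_length w < perm_length (w \<circ> transpose k (Suc k))
     then frag_of (w \<circ> transpose k (Suc k)) else 0)"

text \<open>The action of \<open>c\<^sub>1(L)\<close> for the line bundle \<open>L\<close> of the weight with coordinates \<open>lam\<close> in the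
  basis \<open>\<epsilon>\<^sub>1, \<dots>, \<epsilon>\<^sub>n\<close>. The positive root \<open>\<beta> = \<epsilon>\<^sub>a - \<epsilon>\<^sub>b\<close> is given by \<open>(a, b)\<close>; the pairing of the
  weight with the coroot of \<open>\<beta>\<close> is \<open>lam a - lam b\<close>.\<close>

definition chern_line :: "nat \<Rightarrow> (nat \<Rightarrow> int) \<Rightarrow> flag_homology \<Rightarrow> flag_homology" where
  "chern_line n lam = frag_extend (\<lambda>w.
     \<Sum>(a, b) \<in> {(a, b). 1 \<le> a \<and> a < b \<and> b \<le> n \<and>
                   perm_length w = perm_length (w \<circ> transpose a b) + 1}.
       frag_cmul (lam a - lam b) (frag_of (w \<circ> transpose a b)))"

definition simple_root :: "nat \<Rightarrow> nat \<Rightarrow> int" where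
  "simple_root k = (\<lambda>i. if i = k then 1 else if i = Suc k then - 1 else 0)"

definition homology_reflection :: "nat \<Rightarrow> nat \<Rightarrow> flag_homology \<Rightarrow> flag_homology" where
  "homology_reflection n k x = x - chern_line n (simple_root k) (homology_partial k x)"

definition demazure_lusztig :: "nat \<Rightarrow> nat \<Rightarrow> flag_homology \<Rightarrow> flag_homology" where
  "demazure_lusztig n k x = homology_partial k x - homology_reflection n k x"

text \<open>\<open>C w\<close> is the Chern--Schwartz--MacPherson class of the Schubert cell of \<open>w\<close>, for all
  \<open>w \<in> S\<^sub>n\<close>. MacPherson's transformation itself is not formalized; the classes are given by
  the theorem of Aluffi and Mihalcea, by which they are the unique solution of this
  recursion.\<close>

definition csm_classes :: "nat \<Rightarrow> ((nat \<Rightarrow> nat) \<Rightarrow> flag_homology) \<Rightarrow> bool" where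
  "csm_classes n C \<longleftrightarrow>
     C id = frag_of id \<and>
     (\<forall>w k. w permutes {1..n} \<longrightarrow> 1 \<le> k \<longrightarrow> k < n \<longrightarrow>
        demazure_lusztig n k (C w) = C (w \<circ> transpose k (Suc k)))"

end

theory Submission
  imports Defs
begin

text \<open>
  \<open>FK\<^sub>n\<close> acts on \<open>\<int>[S\<^sub>n]\<close> from the right: \<open>[ij]\<close> with \<open>i < j\<close> sends \<open>w\<close> to \<open>w t\<^sub>i\<^sub>j\<close> if this decreases the
  length, by whatever amount, and to \<open>0\<close> otherwise. In this representation the sum of the
  coefficients of \<open>w \<cdot> M\<close> is \<open>0\<close> or \<open>1\<close> for every monomial \<open>M\<close> in the generators \<open>[ij]\<close>, \<open>i < j\<close>. It
  remains to see that for \<open>M\<close> replaced by \<open>S\<^sub>v(\<theta>)\<close> this sum is \<open>c(w; v)\<close>.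

  The Leibniz rule for \<open>\<partial>\<^sub>k\<close> and \<open>c\<^sub>1(L\<^sub>\<lambda>)\<close> gives the relation of the degenerate affine Hecke algebra
  \<open>c\<^sub>1(L\<^sub>\<lambda>) T\<^sub>k = T\<^sub>k c\<^sub>1(L\<^bsub>s\<^sub>k \<lambda>\<^esub>) + \<langle>\<lambda>, \<alpha>\<^sub>k\<^sup>\<or>\<rangle>\<close>. Hence multiplication by \<open>x\<^sub>i\<close> acts on the CSM classes as
  \<open>\<theta>\<^sub>i\<close> acts on \<open>S\<^sub>n\<close>; since the coefficient of the class of the point is \<open>1\<close> in every CSM class, the
  sum above is the coefficient of the point in \<open>S\<^sub>v(x) c\<^sub>S\<^sub>M(X(w)\<^sup>\<circ>)\<close>. By the duality of Schubert
  polynomials and Schubert classes, which also follows from the Leibniz rule, this is \<open>c(w; v)\<close>.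
\<close>

section \<open>Lengths of permutations\<close>

definition inversions :: "(nat \<Rightarrow> nat) \<Rightarrow> (nat \<times> nat) set" where
  "inversions w = {(i, j). i < j \<and> w j < w i}"

lemma perm_length_eq_card_inversions: "perm_length w = card (inversions w)"
  by (simp add: perm_length_def inversions_def)

text \<open>A position outside \<open>{1..n}\<close> is fixed while \<open>{1..n}\<close> is mapped
  to itself, so it cannot take part in an inversion.\<close>

lemma inversions_permutes_subset:
  assumes "w permutes {1..n}"
  shows "inversions w \<subseteq> {(i, j). 1 \<le> i \<and> i < j \<and> j \<le> n}"
proof (rule subsetI)
  fix p assume "p \<in> inversions w"
  then obtain i j where p: "p = (i, j)" "i < j" "w j < w i"
    by (auto simp: inversions_def)
  have iff: "w x \<in> {1..n} \<longleftrightarrow> x \<in> {1..n}" and fixed: "x \<notin> {1..n} \<Longrightarrow> w x = x" for x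
    using permutes_in_image[OF assms] permutes_not_in[OF assms] by blast+
  have "j \<in> {1..n}"
  proof (rule ccontr)
    assume "j \<notin> {1..n}"
    with fixed[of j] iff[of i] fixed[of i] p show False by auto
  qed
  moreover have "i \<in> {1..n}"
  proof (rule ccontr)
    assume "i \<notin> {1..n}"
    with fixed[of i] iff[of j] fixed[of j] p show False by auto
  qed
  ultimately show "p \<in> {(i, j). 1 \<le> i \<and> i < j \<and> j \<le> n}"
    using p by simp
qed

lemma finite_pairs_upto: "finite {(i, j). 1 \<le> i \<and> i < j \<and> j \<le> (n::nat)}"
  by (rule finite_subset[of _ "{..n} \<times> {..n}"]) auto

lemma finite_inversions: "w permutes {1..n} \<Longrightarrow> finite (inversions w)"
  using finite_subset[OF inversions_permutes_subset finite_pairs_upto] .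

text \<open>For \<open>a < b\<close> and \<open>w a < w b\<close>, emptiness of this set is the
  criterion for the exchange of \<open>a\<close> and \<open>b\<close> to be a covering in Bruhat
  order.\<close>

definition between :: "(nat \<Rightarrow> nat) \<Rightarrow> nat \<Rightarrow> nat \<Rightarrow> nat set" where
  "between w a b = {c. a < c \<and> c < b \<and> w a < w c \<and> w c < w b}"

text \<open>\<open>E\<close> consists of the new inversions; \<open>\<tau>\<close> carries each old inversion along with the exchange,
  unless that would put its two positions in the wrong order.\<close>

lemma inversions_transpose:
  assumes "inj w" "a < b" "w a < w b"
  defines "\<tau> \<equiv> \<lambda>(i, j). if transpose a b i < transpose a b j
                         then (transpose a b i, transpose a b j) else (i, j)"
    and "E \<equiv> insert (a, b) (Pair a ` between w a b \<union> (\<lambda>c. (c, b)) ` between w a b)"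
  shows "inversions (w \<circ> transpose a b) = \<tau> ` inversions w \<union> E"
    and "inj_on \<tau> (inversions w)"
    and "\<tau> ` inversions w \<inter> E = {}"
proof -
  let ?t = "transpose a b"
  have neq: "w x \<noteq> w y" if "x \<noteq> y" for x y
    using \<open>inj w\<close> that by (auto dest: injD)
  have sub: "\<tau> p \<in> inversions (w \<circ> ?t)" if "p \<in> inversions w" for p
    using that assms(2,3) by (auto simp: \<tau>_def inversions_def transpose_def split: if_splits)
  have E: "E \<subseteq> inversions (w \<circ> ?t)"
    using assms(2,3) by (auto simp: E_def between_def inversions_def transpose_def)
  \<comment> \<open>On increasing pairs \<open>\<tau>\<close> is an involution, which gives
    injectivity and lets it also carry new inversions back to old ones.\<close>
  have tau_tau: "\<tau> (\<tau> p) = p" if "fst p < snd p" for p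
    using that by (auto simp: \<tau>_def split_def)
  show "inj_on \<tau> (inversions w)"
    by (rule inj_on_inverseI[of _ \<tau>], rule tau_tau) (auto simp: inversions_def)
  have tau_back: "\<tau> p \<in> inversions w \<longleftrightarrow> p \<notin> E" if p: "p \<in> inversions (w \<circ> ?t)" for p
  proof -
    obtain i j where ij: "p = (i, j)" by force
    have ij': "i < j" "w (?t j) < w (?t i)" using p by (auto simp: ij inversions_def)
    have nab: "w a \<noteq> w x" if "x \<noteq> a" for x using that neq[of a x] by auto
    have nbb: "w b \<noteq> w x" if "x \<noteq> b" for x using that neq[of b x] by auto
    consider "i = a" "j = b" | "i = a" "j < b" | "i = a" "b < j" | "i \<noteq> a" "j = b" "i > a"
      | "i \<noteq> a" "j = b" "i < a" | "i \<noteq> a" "j \<noteq> b" by linarith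
    then show ?thesis
    proof cases
      \<comment> \<open>In cases 2 and 4 the third position lies strictly between \<open>a\<close>
        and \<open>b\<close>, and \<open>\<tau>\<close> leaves the pair in place. Injectivity makes
        the comparison of the third value with \<open>w a\<close> or \<open>w b\<close>
        strict.\<close>
      case 2
      then show ?thesis using ij' nab[of j] assms(2,3)
        by (auto simp: ij \<tau>_def E_def between_def inversions_def transpose_def)
    next
      case 4
      then show ?thesis using ij' nbb[of i] assms(2,3)
        by (auto simp: ij \<tau>_def E_def between_def inversions_def transpose_def)
    next
      case 6
      then show ?thesis using ij' assms(2,3)
        by (auto simp: ij \<tau>_def E_def between_def inversions_def transpose_def split: if_splits)
    qed (use ij' assms(2,3) in \<open>auto simp: ij \<tau>_def E_def between_def inversions_def transpose_def\<close>)
  qed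
  have lt: "fst p < snd p" if "p \<in> inversions u" for p u
    using that by (auto simp: inversions_def)
  show "inversions (w \<circ> ?t) = \<tau> ` inversions w \<union> E"
  proof (intro equalityI subsetI)
    fix p assume p: "p \<in> inversions (w \<circ> ?t)"
    show "p \<in> \<tau> ` inversions w \<union> E"
    proof (cases "p \<in> E")
      case False
      with tau_back[OF p] have "\<tau> p \<in> inversions w" by simp
      then have "\<tau> (\<tau> p) \<in> \<tau> ` inversions w" by (rule imageI)
      then show ?thesis using tau_tau[OF lt[OF p]] by simp
    qed simp
  qed (use sub E in auto)
  show "\<tau> ` inversions w \<inter> E = {}"
  proof (rule ccontr)
    assume "\<tau> ` inversions w \<inter> E \<noteq> {}"
    then obtain q where q: "q \<in> inversions w" "\<tau> q \<in> E" by blast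
    have "\<tau> (\<tau> q) \<in> inversions w" using tau_tau[OF lt[OF q(1)]] q(1) by simp
    then show False using tau_back[OF sub[OF q(1)]] q(2) by simp
  qed
qed

text \<open>The exchange adds the set \<open>?E\<close> to an injective copy of the old inversions.
  \<open>?E\<close> always contains \<open>(a, b)\<close>, and it is a singleton exactly when
  nothing lies in between.\<close>

lemma perm_length_transpose:
  assumes "w permutes {1..n}" "a < b" "w a < w b"
  shows "perm_length w < perm_length (w \<circ> transpose a b)"
    and "perm_length (w \<circ> transpose a b) = perm_length w + 1 \<longleftrightarrow> between w a b = {}"
proof -
  let ?B = "between w a b"
  let ?E = "insert (a, b) (Pair a ` ?B \<union> (\<lambda>c. (c, b)) ` ?B)"
  have finB: "finite ?B"
    by (rule finite_subset[of _ "{..b}"]) (auto simp: between_def)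
  have finE: "finite ?E" using finB by simp
  have card: "perm_length (w \<circ> transpose a b) = perm_length w + card ?E"
    unfolding perm_length_eq_card_inversions
      inversions_transpose(1)[OF permutes_inj[OF assms(1)] assms(2,3)]
    using inversions_transpose(2,3)[OF permutes_inj[OF assms(1)] assms(2,3)]
      finite_inversions[OF assms(1)] finE
    by (subst card_Un_disjoint) (auto simp: card_image)
  have pos: "card ?E > 0" using finE by (simp add: card_gt_0_iff)
  then show "perm_length w < perm_length (w \<circ> transpose a b)" using card by simp
  have "?B = {}" if "card ?E = 1"
  proof (rule ccontr)
    assume "?B \<noteq> {}"
    then obtain c where c: "c \<in> ?B" by blast
    then have "(a, c) \<in> ?E" "(a, b) \<in> ?E" "c \<noteq> b" by (auto simp: between_def)
    then show False using that by (metis card_1_singletonE prod.inject singletonD)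
  qed
  moreover have "card ?E = 1" if "?B = {}" using that by simp
  ultimately show "perm_length (w \<circ> transpose a b) = perm_length w + 1 \<longleftrightarrow> ?B = {}"
    using card by auto
qed

lemma permutes_comp_transpose:
  assumes "w permutes {1..n}" "1 \<le> a" "a \<le> n" "1 \<le> b" "b \<le> n"
  shows "w \<circ> transpose a b permutes {1..n}"
  using assms by (intro permutes_compose permutes_swap_id) auto

lemma permutes_eq_iff: "w permutes S \<Longrightarrow> w x = w y \<longleftrightarrow> x = y"
  by (rule inj_eq[OF permutes_inj])

lemma perm_length_descent_transpose:
  assumes "w permutes {1..n}" "1 \<le> a" "a < b" "b \<le> n" "w b < w a"
  shows "perm_length (w \<circ> transpose a b) < perm_length w"
    and "perm_length w = perm_length (w \<circ> transpose a b) + 1 \<longleftrightarrow>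
         between (w \<circ> transpose a b) a b = {}"
  using perm_length_transpose[OF permutes_comp_transpose[OF assms(1), of a b], of a b] assms
  by (auto simp: o_assoc[symmetric])

lemma perm_length_transpose_less_iff:
  assumes "w permutes {1..n}" "1 \<le> a" "a < b" "b \<le> n"
  shows "perm_length (w \<circ> transpose a b) < perm_length w \<longleftrightarrow> w b < w a"
    and "perm_length w < perm_length (w \<circ> transpose a b) \<longleftrightarrow> w a < w b"
  using perm_length_transpose(1)[OF assms(1,3)] perm_length_descent_transpose(1)[OF assms]
    permutes_eq_iff[OF assms(1), of a b] assms(3) by (meson less_asym nat_neq_iff)+

text \<open>No position lies strictly between \<open>k\<close> and \<open>Suc k\<close>.\<close>

lemma perm_length_adjacent:
  assumes "w permutes {1..n}" "1 \<le> k" "k < n"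
  shows "w k < w (Suc k) \<Longrightarrow> perm_length (w \<circ> transpose k (Suc k)) = perm_length w + 1"
    and "w (Suc k) < w k \<Longrightarrow> perm_length w = perm_length (w \<circ> transpose k (Suc k)) + 1"
  using perm_length_transpose(2)[OF assms(1), of k "Suc k"]
    perm_length_descent_transpose(2)[OF assms(1), of k "Suc k"] assms
  by (auto simp: between_def)

lemma permutes_comp_adjacent:
  assumes "w permutes {1..n}" "1 \<le> k" "k < n"
  shows "w \<circ> transpose k (Suc k) permutes {1..n}"
  using permutes_comp_transpose[of w n k "Suc k"] assms by simp

section \<open>Descents, ascents and the longest element\<close>

lemma strict_mono_permutes_eq_id:
  assumes "w permutes S" "strict_mono (w :: nat \<Rightarrow> nat)"
  shows "w = id"
proof (rule ext)
  fix x
  have "strict_mono (inv w)"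
  proof (rule strict_monoI)
    fix i j :: nat assume "i < j"
    then show "inv w i < inv w j"
      by (metis assms permutes_inverses(1) strict_mono_less)
  qed
  \<comment> \<open>A strictly increasing self-map of the naturals never drops below its argument;
    applied to \<open>w\<close> and its inverse this forces equality.\<close>
  then have "x \<le> inv w x" "x \<le> w x"
    using assms(2) by (auto intro: strict_mono_imp_increasing)
  moreover have "w x \<le> w (inv w x)" if "x \<le> inv w x"
    using that assms(2) by (simp add: strict_mono_less_eq)
  ultimately show "w x = id x"
    by (metis assms(1) id_apply le_antisym permutes_inverses(1))
qed

lemma exists_descent:
  assumes "w permutes {1..n}" "w \<noteq> id"
  obtains k where "1 \<le> k" "k < n" "w (Suc k) < w k"
proof -
  have "\<not> strict_mono w" using strict_mono_permutes_eq_id assms by blast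
  then obtain k where k: "\<not> w k < w (Suc k)" by (auto simp: strict_mono_Suc_iff)
  then have desc: "w (Suc k) < w k"
    using permutes_eq_iff[OF assms(1), of k "Suc k"] by linarith
  \<comment> \<open>Read as an inversion, the descent must lie inside \<open>{1..n}\<close>; this
    bounds \<open>k\<close>.\<close>
  then have "(k, Suc k) \<in> inversions w" by (simp add: inversions_def)
  then show ?thesis using inversions_permutes_subset[OF assms(1)] desc that by auto
qed

lemma longest_perm_permutes: "longest_perm n permutes {1..n}"
  by (rule bij_imp_permutes, rule bij_betwI[of _ _ _ "longest_perm n"])
    (auto simp: longest_perm_def)

lemma inversions_longest_perm:
  "inversions (longest_perm n) = {(i, j). 1 \<le> i \<and> i < j \<and> j \<le> n}"
  using inversions_permutes_subset[OF longest_perm_permutes]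
  by (auto simp: inversions_def longest_perm_def)

lemma perm_length_le_longest_perm:
  assumes "w permutes {1..n}"
  shows "perm_length w \<le> perm_length (longest_perm n)"
  unfolding perm_length_eq_card_inversions inversions_longest_perm
  using inversions_permutes_subset[OF assms] finite_pairs_upto by (intro card_mono)

text \<open>Composition with the longest element reverses the positions, so a descent of
  \<open>?u\<close> at \<open>k\<close> is an ascent of \<open>w\<close> at
  \<open>n - k\<close>.\<close>

lemma exists_ascent:
  assumes "w permutes {1..n}" "w \<noteq> longest_perm n"
  obtains k where "1 \<le> k" "k < n" "w k < w (Suc k)"
proof -
  let ?u = "w \<circ> longest_perm n"
  have invol: "longest_perm n \<circ> longest_perm n = id"
    by (auto simp: longest_perm_def fun_eq_iff)
  have "?u \<noteq> id"
  proof
    assume "?u = id"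
    then have "w \<circ> (longest_perm n \<circ> longest_perm n) = longest_perm n"
      by (simp add: o_assoc)
    then show False using assms(2) invol by simp
  qed
  with exists_descent[OF permutes_compose[OF longest_perm_permutes assms(1)]]
  obtain k where k: "1 \<le> k" "k < n" "?u (Suc k) < ?u k" by blast
  have "longest_perm n (Suc k) = n - k" "longest_perm n k = Suc (n - k)"
    using k by (auto simp: longest_perm_def)
  with k show ?thesis by (intro that[of "n - k"]) auto
qed

lemma perm_length_longest_perm_unique:
  assumes "w permutes {1..n}" "perm_length w = perm_length (longest_perm n)"
  shows "w = longest_perm n"
proof (rule ccontr)
  assume "w \<noteq> longest_perm n"
  with assms(1) obtain k where k: "1 \<le> k" "k < n" "w k < w (Suc k)" by (rule exists_ascent)
  then show False
    using perm_length_adjacent(1)[OF assms(1)] assms(2)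
      perm_length_le_longest_perm[OF permutes_comp_adjacent[OF assms(1)], of k] by simp
qed

lemma perm_length_id: "perm_length id = 0"
  by (auto simp: perm_length_eq_card_inversions inversions_def card_eq_0_iff)

section \<open>Operators on the homology of the flag variety\<close>

text \<open>The type \<open>flag_homology\<close> has a basis element for every function; this
  predicate cuts out the homology of the flag variety for a fixed \<open>n\<close>.\<close>

definition supported :: "nat \<Rightarrow> flag_homology \<Rightarrow> bool" where
  "supported n x \<longleftrightarrow> Poly_Mapping.keys x \<subseteq> {w. w permutes {1..n}}"

lemma supported_induct [consumes 1, case_names zero basis diff]:
  assumes "supported n x" "P 0" "\<And>w. w permutes {1..n} \<Longrightarrow> P (frag_of w)"
    "\<And>x y. P x \<Longrightarrow> P y \<Longrightarrow> P (x - y)"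
  shows "P x"
  using frag_induction[of x "{w. w permutes {1..n}}" P] assms by (simp add: supported_def)

lemma supported_0 [simp]: "supported n 0"
  by (simp add: supported_def)

lemma supported_frag_of: "w permutes {1..n} \<Longrightarrow> supported n (frag_of w)"
  by (simp add: supported_def)

lemma supported_diff: "supported n x \<Longrightarrow> supported n y \<Longrightarrow> supported n (x - y)"
  unfolding supported_def using keys_diff[of x y] by blast

lemma supported_cmul: "supported n x \<Longrightarrow> supported n (frag_cmul c x)"
  unfolding supported_def using keys_cmul[of c x] by blast

lemma supported_sum: "(\<And>i. i \<in> I \<Longrightarrow> supported n (f i)) \<Longrightarrow> supported n (sum f I)"
  unfolding supported_def using keys_sum[of f I] by blast

text \<open>The contribution of a single root to Chevalley's formula, set to 0 when it is not a
  covering. The formula then sums over all positive roots, a range independent of \<open>w\<close>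
  that can be reindexed by \<open>s_k\<close>.\<close>

definition cover_term :: "nat \<Rightarrow> nat \<Rightarrow> (nat \<Rightarrow> nat) \<Rightarrow> flag_homology" where
  "cover_term a b w = (if perm_length w = perm_length (w \<circ> transpose a b) + 1
                       then frag_of (w \<circ> transpose a b) else 0)"

definition index_pairs :: "nat \<Rightarrow> (nat \<times> nat) set" where
  "index_pairs n = {(a, b). 1 \<le> a \<and> a < b \<and> b \<le> n}"

lemma finite_index_pairs [simp]: "finite (index_pairs n)"
  using finite_pairs_upto by (simp add: index_pairs_def)

lemma chern_line_frag_of:
  "chern_line n lam (frag_of w) =
     (\<Sum>(a, b) \<in> index_pairs n. frag_cmul (lam a - lam b) (cover_term a b w))"
  unfolding chern_line_def frag_extend_of
  by (rule sum.mono_neutral_cong_left) (auto simp: cover_term_def index_pairs_def split: if_splits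
      intro: finite_subset[OF _ finite_index_pairs[of n]])

lemma chern_line_0 [simp]: "chern_line n lam 0 = 0"
  and chern_line_add: "chern_line n lam (x + y) = chern_line n lam x + chern_line n lam y"
  and chern_line_diff: "chern_line n lam (x - y) = chern_line n lam x - chern_line n lam y"
  and chern_line_cmul: "chern_line n lam (frag_cmul c x) = frag_cmul c (chern_line n lam x)"
  by (simp_all add: chern_line_def frag_extend_add frag_extend_diff frag_extend_cmul)

lemma homology_partial_0 [simp]: "homology_partial k 0 = 0"
  and homology_partial_add:
    "homology_partial k (x + y) = homology_partial k x + homology_partial k y"
  and homology_partial_diff:
    "homology_partial k (x - y) = homology_partial k x - homology_partial k y"
  and homology_partial_cmul:
    "homology_partial k (frag_cmul c x) = frag_cmul c (homology_partial k x)"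
  by (simp_all add: homology_partial_def frag_extend_add frag_extend_diff frag_extend_cmul)

lemma frag_cmul_diff_right: "frag_cmul c (x - y) = frag_cmul c x - frag_cmul c y"
  by (simp add: poly_mapping_eq_iff fun_eq_iff lookup_minus algebra_simps)

lemma chern_line_weight_lincomb:
  "chern_line n (\<lambda>i. c * lam i + d * mu i) x =
     frag_cmul c (chern_line n lam x) + frag_cmul d (chern_line n mu x)"
proof -
  have basis: "chern_line n (\<lambda>i. c * lam i + d * mu i) (frag_of w) =
      frag_cmul c (chern_line n lam (frag_of w)) + frag_cmul d (chern_line n mu (frag_of w))" for w
    unfolding chern_line_frag_of frag_cmul_sum sum.distrib[symmetric]
    by (rule sum.cong) (auto simp: frag_cmul_distrib[symmetric] algebra_simps)
  show ?thesis
    using subset_UNIV[of "Poly_Mapping.keys x"] by (induction x rule: frag_induction)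
      (auto simp: basis chern_line_diff poly_mapping_eq_iff lookup_minus lookup_add fun_eq_iff algebra_simps)
qed

lemma supported_cover_term:
  assumes "(a, b) \<in> index_pairs n" "w permutes {1..n}"
  shows "supported n (cover_term a b w)"
  using permutes_comp_transpose[OF assms(2), of a b] assms(1)
  by (simp add: cover_term_def supported_frag_of index_pairs_def)

lemma supported_chern_line: "supported n x \<Longrightarrow> supported n (chern_line n lam x)"
  by (induction rule: supported_induct)
    (auto simp: chern_line_diff supported_diff chern_line_frag_of
      intro!: supported_sum supported_cmul supported_cover_term)

lemma homology_partial_frag_of:
  assumes "w permutes {1..n}" "1 \<le> k" "k < n"
  shows "homology_partial k (frag_of w) =
           (if w k < w (Suc k) then frag_of (w \<circ> transpose k (Suc k)) else 0)"
  using perm_length_transpose_less_iff(2)[OF assms(1,2), of "Suc k"] assms(3)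
  by (simp add: homology_partial_def)

lemma supported_homology_partial:
  assumes "supported n x" "1 \<le> k" "k < n"
  shows "supported n (homology_partial k x)"
  using assms(1) by (induction rule: supported_induct)
    (simp_all add: homology_partial_diff supported_diff homology_partial_frag_of assms(2,3)
      supported_frag_of permutes_comp_adjacent del: One_nat_def)

text \<open>A length-increasing covering can turn an ascent at \<open>k\<close> into a descent only by exchanging
  the positions \<open>k\<close> and \<open>k + 1\<close> themselves: any other exchange leaves a value in between.\<close>

lemma cover_creates_descent:
  assumes "w permutes {1..n}" "(a, b) \<in> index_pairs n"
    and "perm_length (w \<circ> transpose a b) = perm_length w + 1"
    and "w k < w (Suc k)" "(w \<circ> transpose a b) (Suc k) < (w \<circ> transpose a b) k"
  shows "(a, b) = (k, Suc k)"
proof -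
  have ab: "1 \<le> a" "a < b" "b \<le> n" using assms(2) by (auto simp: index_pairs_def)
  then have lt: "w a < w b"
    using perm_length_transpose_less_iff(2)[OF assms(1), of a b] assms(3) by simp
  then have "between w a b = {}"
    using perm_length_transpose(2)[OF assms(1)] ab assms(3) by simp
  then have empty: "\<not> (a < c \<and> c < b \<and> w a < w c \<and> w c < w b)" for c
    by (auto simp: between_def)
  show ?thesis
    using empty[of k] empty[of "Suc k"] assms(4,5) ab lt
    by (auto simp: transpose_def split: if_splits)
qed

lemma transpose_conj:
  "w \<circ> transpose k l \<circ> transpose (transpose k l a) (transpose k l b) = w \<circ> transpose a b \<circ> transpose k l"
  by (auto simp: fun_eq_iff transpose_def)

text \<open>Both sides are the class of \<open>w \<circ> transpose a b \<circ> s\<close> or 0. By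
  \<open>up\<close> and \<open>down\<close>, a covering by a root other than the simple one neither
  creates nor, read backwards, destroys a descent at \<open>k\<close>; so the two nonvanishing
  conditions agree.\<close>

lemma homology_partial_cover_term:
  assumes w: "w permutes {1..n}" and ab: "(a, b) \<in> index_pairs n" and k: "1 \<le> k" "k < n"
    and neq: "(a, b) \<noteq> (k, Suc k)"
  defines "s \<equiv> transpose k (Suc k)"
  shows "homology_partial k (cover_term a b w) =
           frag_extend (cover_term (s a) (s b)) (homology_partial k (frag_of w))"
proof -
  let ?t = "transpose a b"
  have wt: "w \<circ> ?t permutes {1..n}"
    using permutes_comp_transpose[OF w, of a b] ab by (auto simp: index_pairs_def)
  note adj_w = perm_length_adjacent[OF w k, folded s_def]
    and adj_wt = perm_length_adjacent[OF wt k, folded s_def]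
  have ne: "w k \<noteq> w (Suc k)" "(w \<circ> ?t) k \<noteq> (w \<circ> ?t) (Suc k)"
    using permutes_eq_iff[OF w, of k "Suc k"] permutes_eq_iff[OF wt, of k "Suc k"] by auto
  have up: "\<not> (perm_length (w \<circ> ?t) = perm_length w + 1 \<and> w k < w (Suc k) \<and>
              (w \<circ> ?t) (Suc k) < (w \<circ> ?t) k)"
    using cover_creates_descent[OF w ab] neq by blast
  have down: "\<not> (perm_length w = perm_length (w \<circ> ?t) + 1 \<and> w (Suc k) < w k \<and>
              (w \<circ> ?t) k < (w \<circ> ?t) (Suc k))"
    using cover_creates_descent[OF wt ab] neq by (auto simp: o_assoc[symmetric])
  have "perm_length w = perm_length (w \<circ> ?t) + 1 \<and> (w \<circ> ?t) k < (w \<circ> ?t) (Suc k) \<longleftrightarrow>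
      w k < w (Suc k) \<and> perm_length (w \<circ> s) = perm_length (w \<circ> ?t \<circ> s) + 1"
    using up down ne adj_w adj_wt by linarith
  then show ?thesis
    unfolding cover_term_def
    by (auto simp: homology_partial_frag_of[OF w k] homology_partial_frag_of[OF wt k]
        transpose_conj s_def[symmetric] transpose_conj[of w k "Suc k" a b, folded s_def])
qed

text \<open>Exactly one summand is nonzero: the second if \<open>w\<close> ascends at
  \<open>k\<close>, the first if it descends. This is the source of the correction term in the
  Leibniz rule.\<close>

lemma homology_partial_cover_term_adjacent:
  assumes w: "w permutes {1..n}" and k: "1 \<le> k" "k < n"
  shows "homology_partial k (cover_term k (Suc k) w) +
           frag_extend (cover_term k (Suc k)) (homology_partial k (frag_of w)) = frag_of w"
proof -
  let ?s = "transpose k (Suc k)"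
  have ne: "w k \<noteq> w (Suc k)" using permutes_eq_iff[OF w, of k "Suc k"] by auto
  have [simp]: "w \<circ> ?s \<circ> ?s = w" by (simp add: o_assoc[symmetric])
  show ?thesis
  proof (cases "w k < w (Suc k)")
    case True
    then show ?thesis using perm_length_adjacent[OF w k]
      by (simp add: homology_partial_frag_of[OF w k] cover_term_def)
  next
    case False
    then have "w (Suc k) < w k" using ne by simp
    then show ?thesis using perm_length_adjacent[OF w k]
      by (simp add: homology_partial_frag_of[OF w k] cover_term_def
          homology_partial_frag_of[OF permutes_comp_adjacent[OF w k] k])
  qed
qed

text \<open>The simple reflection \<open>s_k\<close> permutes the positive roots other than
  \<open>\<alpha>_k\<close>.\<close>

lemma bij_betw_transpose_index_pairs:
  assumes "1 \<le> k" "k < n"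
  shows "bij_betw (\<lambda>(a, b). (transpose k (Suc k) a, transpose k (Suc k) b))
           (index_pairs n - {(k, Suc k)}) (index_pairs n - {(k, Suc k)})"
  by (rule bij_betw_byWitness[where f' = "\<lambda>(a, b). (transpose k (Suc k) a, transpose k (Suc k) b)"])
    (use assms in \<open>auto simp: index_pairs_def transpose_def split: if_splits\<close>)

lemma homology_partial_sum: "homology_partial k (sum f I) = (\<Sum>i\<in>I. homology_partial k (f i))"
  by (induction I rule: infinite_finite_induct) (simp_all add: homology_partial_add)

text \<open>The Leibniz rule. The root \<open>\<alpha>_k\<close> is split off from Chevalley's
  formula; on the other roots \<open>s_k\<close> acts by a permutation that preserves the pairing
  with the reflected weight.\<close>

lemma homology_partial_chern_line:
  assumes x: "supported n x" and k: "1 \<le> k" "k < n"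
  shows "homology_partial k (chern_line n lam x) =
           chern_line n (lam \<circ> transpose k (Suc k)) (homology_partial k x) +
           frag_cmul (lam k - lam (Suc k)) x"
  using x
proof (induction rule: supported_induct)
  case (basis w)
  let ?s = "transpose k (Suc k)" and ?I = "index_pairs n - {(k, Suc k)}"
    and ?y = "homology_partial k (frag_of w)"
  have ins: "index_pairs n = insert (k, Suc k) ?I" using k by (auto simp: index_pairs_def)
  have chern: "chern_line n mu ?y =
      (\<Sum>(a, b) \<in> index_pairs n. frag_cmul (mu a - mu b) (frag_extend (cover_term a b) ?y))" for mu
    by (simp add: homology_partial_frag_of[OF basis k] chern_line_frag_of)
  have term_eq: "homology_partial k (cover_term (fst p) (snd p) w) =
      frag_extend (cover_term (?s (fst p)) (?s (snd p))) ?y" if "p \<in> ?I" for p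
    using that homology_partial_cover_term[OF basis _ k, of "fst p" "snd p"] by auto
  have "homology_partial k (chern_line n lam (frag_of w)) =
      (\<Sum>(a, b) \<in> index_pairs n. frag_cmul (lam a - lam b) (homology_partial k (cover_term a b w)))"
    unfolding chern_line_frag_of homology_partial_sum
    by (rule sum.cong) (auto simp: homology_partial_cmul)
  also have "\<dots> = frag_cmul (lam k - lam (Suc k)) (homology_partial k (cover_term k (Suc k) w)) +
      (\<Sum>(a, b) \<in> ?I. frag_cmul (lam a - lam b) (homology_partial k (cover_term a b w)))"
    by (subst ins, subst sum.insert) auto
  also have "(\<Sum>(a, b) \<in> ?I. frag_cmul (lam a - lam b) (homology_partial k (cover_term a b w))) =
      (\<Sum>(a, b) \<in> ?I. frag_cmul ((lam \<circ> ?s) (?s a) - (lam \<circ> ?s) (?s b))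
                       (frag_extend (cover_term (?s a) (?s b)) ?y))"
    unfolding split_def by (rule sum.cong[OF refl]) (simp only: term_eq o_apply transpose_involutory)
  also have "\<dots> = (\<Sum>(a, b) \<in> ?I. frag_cmul ((lam \<circ> ?s) a - (lam \<circ> ?s) b)
                       (frag_extend (cover_term a b) ?y))"
    using sum.reindex_bij_betw[OF bij_betw_transpose_index_pairs[OF k],
      of "\<lambda>(a, b). frag_cmul ((lam \<circ> ?s) a - (lam \<circ> ?s) b) (frag_extend (cover_term a b) ?y)"]
    by (simp add: split_def)
  \<comment> \<open>The term of \<open>\<alpha>_k\<close> is added and subtracted to complete the
    sum. What is subtracted cancels against the \<open>cover_term\<close> part of the next step,
    leaving a multiple of \<open>frag_of w\<close>.\<close>
  also have "\<dots> = chern_line n (lam \<circ> ?s) ?y -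
      frag_cmul (lam (Suc k) - lam k) (frag_extend (cover_term k (Suc k)) ?y)"
    unfolding chern by (subst ins, subst sum.insert) auto
  also have "homology_partial k (cover_term k (Suc k) w) =
      frag_of w - frag_extend (cover_term k (Suc k)) ?y"
    using homology_partial_cover_term_adjacent[OF basis k] by (simp add: eq_diff_eq)
  finally show ?case
    by (auto simp: poly_mapping_eq_iff lookup_minus lookup_add fun_eq_iff algebra_simps)
qed (simp_all add: chern_line_diff homology_partial_diff frag_cmul_diff_right)

text \<open>The reflection formula \<open>s_k(lam) = lam - (lam k - lam (Suc k)) \<alpha>_k\<close>,
  together with linearity in the weight.\<close>

lemma chern_line_reflected_weight:
  "chern_line n (lam \<circ> transpose k (Suc k)) x =
     chern_line n lam x - frag_cmul (lam k - lam (Suc k)) (chern_line n (simple_root k) x)"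
proof -
  have eq: "lam \<circ> transpose k (Suc k) = (\<lambda>i. 1 * lam i + (lam (Suc k) - lam k) * simple_root k i)"
    by (auto simp: fun_eq_iff simple_root_def transpose_def)
  show ?thesis
    unfolding eq chern_line_weight_lincomb
    by (auto simp: poly_mapping_eq_iff lookup_minus lookup_add fun_eq_iff algebra_simps)
qed

text \<open>The commutator of two of the operators intertwines with \<^const>\<open>homology_partial\<close> up to
  reflecting both weights, so it vanishes on every class obtained from the class of the point.\<close>

lemma chern_line_commute:
  assumes "supported n x"
  shows "chern_line n lam (chern_line n mu x) = chern_line n mu (chern_line n lam x)"
proof -
  have "chern_line n lam (chern_line n mu (frag_of w)) =
        chern_line n mu (chern_line n lam (frag_of w))" if "w permutes {1..n}" for w
    using that
  proof (induction "perm_length w" arbitrary: w lam mu rule: less_induct)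
    case less
    show ?case
    proof (cases "w = id")
      case True
      have "chern_line n nu (frag_of w) = 0" for nu
        unfolding True chern_line_frag_of
        by (rule sum.neutral) (auto simp: cover_term_def perm_length_id)
      then show ?thesis by simp
    next
      case False
      with less.prems obtain k where k: "1 \<le> k" "k < n" "w (Suc k) < w k" by (rule exists_descent)
      let ?s = "transpose k (Suc k)"
      let ?v = "w \<circ> ?s"
      have v: "?v permutes {1..n}" using permutes_comp_adjacent[OF less.prems k(1,2)] .
      have "?v k < ?v (Suc k)" using k(3) by simp
      then have w: "homology_partial k (frag_of ?v) = frag_of w"
        using homology_partial_frag_of[OF v k(1,2)] by (simp add: o_assoc[symmetric])
      have sup: "supported n (frag_of ?v)" using supported_frag_of[OF v] .
      have IH: "chern_line n a (chern_line n b (frag_of ?v)) =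
          chern_line n b (chern_line n a (frag_of ?v))" for a b
        using less.hyps[OF _ v] perm_length_adjacent(2)[OF less.prems k(1,2,3)] by simp
      have twice: "homology_partial k (chern_line n a (chern_line n b (frag_of ?v))) =
          chern_line n (a \<circ> ?s) (chern_line n (b \<circ> ?s) (frag_of w)) +
          frag_cmul (b k - b (Suc k)) (chern_line n (a \<circ> ?s) (frag_of ?v)) +
          frag_cmul (a k - a (Suc k)) (chern_line n b (frag_of ?v))" for a b
        using k(1,2) sup
        by (simp add: homology_partial_chern_line supported_chern_line chern_line_add chern_line_cmul w)
      have invol: "a \<circ> ?s \<circ> ?s = a" for a :: "nat \<Rightarrow> int" by (simp add: o_assoc[symmetric])
      have "chern_line n lam (chern_line n mu (frag_of w)) +
          frag_cmul (mu (Suc k) - mu k) (chern_line n lam (frag_of ?v)) +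
          frag_cmul (lam (Suc k) - lam k) (chern_line n (mu \<circ> ?s) (frag_of ?v)) =
          chern_line n mu (chern_line n lam (frag_of w)) +
          frag_cmul (lam (Suc k) - lam k) (chern_line n mu (frag_of ?v)) +
          frag_cmul (mu (Suc k) - mu k) (chern_line n (lam \<circ> ?s) (frag_of ?v))"
        \<comment> \<open>The weights are reflected beforehand, so that the reflections from the
          Leibniz rule restore \<open>lam\<close> and \<open>mu\<close>. Expanding the remaining
          reflected weights makes the corrections symmetric in \<open>lam\<close> and
          \<open>mu\<close>.\<close>
        using arg_cong[OF IH[of "lam \<circ> ?s" "mu \<circ> ?s"], of "homology_partial k"]
        unfolding twice invol by simp
      then show ?thesis
        unfolding chern_line_reflected_weight
        by (auto simp: poly_mapping_eq_iff lookup_minus lookup_add fun_eq_iff algebra_simps)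
    qed
  qed
  with assms show ?thesis
    by (induction rule: supported_induct) (simp_all add: chern_line_diff)
qed

section \<open>CSM classes\<close>

text \<open>The transposed form of the operator, acting on coefficients: it moves the index down at
  a descent, just as the recursion of the Schubert polynomials does.\<close>

lemma lookup_homology_partial:
  assumes x: "supported n x" and v: "v permutes {1..n}" and k: "1 \<le> k" "k < n"
  shows "Poly_Mapping.lookup (homology_partial k x) v =
           (if v (Suc k) < v k then Poly_Mapping.lookup x (v \<circ> transpose k (Suc k)) else 0)"
  using x
proof (induction rule: supported_induct)
  case (basis w)
  have "w \<circ> transpose k (Suc k) = v \<longleftrightarrow> w = v \<circ> transpose k (Suc k)"
    by (auto simp: o_assoc[symmetric])
  then show ?case
    using permutes_eq_iff[OF v, of k "Suc k"]
    by (auto simp: homology_partial_frag_of[OF basis k] lookup_single when_def)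
next
  case (diff x y)
  then show "Poly_Mapping.lookup (homology_partial k (x - y)) v =
      (if v (Suc k) < v k then Poly_Mapping.lookup (x - y) (v \<circ> transpose k (Suc k)) else 0)"
    by (auto simp: homology_partial_diff lookup_minus o_def)
qed simp

lemma lookup_homology_partial_id:
  assumes "supported n x" "1 \<le> k" "k < n"
  shows "Poly_Mapping.lookup (homology_partial k x) id = 0"
  using lookup_homology_partial[OF assms(1) permutes_id assms(2,3)] by simp

section \<open>Demazure--Lusztig operators and the degenerate affine Hecke relation\<close>

lemma demazure_lusztig_eq:
  "demazure_lusztig n k x =
     homology_partial k x - x + chern_line n (simple_root k) (homology_partial k x)"
  by (simp add: demazure_lusztig_def homology_reflection_def)

lemma demazure_lusztig_0 [simp]: "demazure_lusztig n k 0 = 0"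
  and demazure_lusztig_add:
    "demazure_lusztig n k (x + y) = demazure_lusztig n k x + demazure_lusztig n k y"
  and demazure_lusztig_cmul:
    "demazure_lusztig n k (frag_cmul c x) = frag_cmul c (demazure_lusztig n k x)"
  by (simp_all add: demazure_lusztig_eq homology_partial_add chern_line_add homology_partial_cmul
      chern_line_cmul frag_cmul_diff_right frag_cmul_distrib2)

lemma demazure_lusztig_sum:
  "demazure_lusztig n k (sum f I) = (\<Sum>i\<in>I. demazure_lusztig n k (f i))"
  by (induction I rule: infinite_finite_induct) (simp_all add: demazure_lusztig_add)

lemma supported_add: "supported n x \<Longrightarrow> supported n y \<Longrightarrow> supported n (x + y)"
  unfolding supported_def using Poly_Mapping.keys_add[of x y] by blast

lemma supported_demazure_lusztig:
  assumes "supported n x" "1 \<le> k" "k < n"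
  shows "supported n (demazure_lusztig n k x)"
  unfolding demazure_lusztig_eq
  by (intro supported_add supported_diff supported_chern_line supported_homology_partial assms)

text \<open>By the Leibniz rule for \<open>\<alpha>_k\<close>, whose pairing with its own coroot is
  2, the operator is the identity plus terms in the image of \<open>homology_partial k\<close>. Such
  terms do not contain the class of the point.\<close>

lemma lookup_demazure_lusztig_id:
  assumes x: "supported n x" and k: "1 \<le> k" "k < n"
  shows "Poly_Mapping.lookup (demazure_lusztig n k x) id = Poly_Mapping.lookup x id"
proof -
  have "homology_partial k (chern_line n (simple_root k) x) =
      frag_cmul 2 x - chern_line n (simple_root k) (homology_partial k x)"
    unfolding homology_partial_chern_line[OF x k] chern_line_reflected_weight
    by (auto simp: simple_root_def poly_mapping_eq_iff lookup_minus lookup_add fun_eq_iff)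
  then have "chern_line n (simple_root k) (homology_partial k x) =
      frag_cmul 2 x - homology_partial k (chern_line n (simple_root k) x)" by simp
  then show ?thesis
    using lookup_homology_partial_id[OF x k]
      lookup_homology_partial_id[OF supported_chern_line[OF x] k]
    by (simp add: demazure_lusztig_eq lookup_add lookup_minus)
qed

text \<open>The Leibniz rule is applied to the reflected weight; commutativity moves the operator of
  \<open>lam\<close> past that of \<open>simple_root k\<close>.\<close>

lemma chern_line_demazure_lusztig:
  assumes x: "supported n x" and k: "1 \<le> k" "k < n"
  shows "chern_line n lam (demazure_lusztig n k x) =
           demazure_lusztig n k (chern_line n (lam \<circ> transpose k (Suc k)) x) +
           frag_cmul (lam k - lam (Suc k)) x"
proof -
  have invol: "lam \<circ> transpose k (Suc k) \<circ> transpose k (Suc k) = lam"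
    by (simp add: o_assoc[symmetric])
  show ?thesis
    unfolding demazure_lusztig_eq homology_partial_chern_line[OF x k] invol
    by (auto simp: chern_line_reflected_weight[of n lam k x] chern_line_add chern_line_diff
        chern_line_cmul chern_line_commute[OF supported_homology_partial[OF x k], of lam "simple_root k"]
        poly_mapping_eq_iff lookup_minus lookup_add fun_eq_iff algebra_simps)
qed

text \<open>The recursion holds whether the length rises or falls, so it can be applied to
  \<open>w \<circ> transpose k (Suc k)\<close>, which leads back to \<open>w\<close>.\<close>

lemma csm_classes_descend:
  assumes "csm_classes n C" "w permutes {1..n}" "1 \<le> k" "k < n"
  shows "C w = demazure_lusztig n k (C (w \<circ> transpose k (Suc k)))"
proof -
  have "demazure_lusztig n k (C (w \<circ> transpose k (Suc k))) =
      C (w \<circ> transpose k (Suc k) \<circ> transpose k (Suc k))"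
    using assms permutes_comp_adjacent[OF assms(2-4)] unfolding csm_classes_def by blast
  then show ?thesis by (simp add: o_assoc[symmetric])
qed

lemma permutes_descent_induct [consumes 1, case_names id descent]:
  assumes "w permutes {1..n}" "P id"
    "\<And>w k. w permutes {1..n} \<Longrightarrow> 1 \<le> k \<Longrightarrow> k < n \<Longrightarrow> w (Suc k) < w k \<Longrightarrow>
       P (w \<circ> transpose k (Suc k)) \<Longrightarrow> P w"
  shows "P w"
  using assms(1)
proof (induction "perm_length w" arbitrary: w rule: less_induct)
  case less
  show ?case
  proof (cases "w = id")
    case False
    with less.prems obtain k where k: "1 \<le> k" "k < n" "w (Suc k) < w k" by (rule exists_descent)
    then show ?thesis
      using less.hyps[OF _ permutes_comp_adjacent[OF less.prems]] assms(3)[OF less.prems]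
        perm_length_adjacent(2)[OF less.prems] by simp
  qed (use assms(2) in simp)
qed

lemma csm_classes_supported:
  assumes "csm_classes n C" "w permutes {1..n}"
  shows "supported n (C w)"
  using assms(2)
proof (induction rule: permutes_descent_induct)
  case id
  show "supported n (C id)"
    using assms(1) by (simp add: csm_classes_def supported_frag_of permutes_id)
next
  case (descent w k)
  then show ?case
    using csm_classes_descend[OF assms(1)] supported_demazure_lusztig by metis
qed

lemma csm_classes_lookup_id:
  assumes "csm_classes n C" "w permutes {1..n}"
  shows "Poly_Mapping.lookup (C w) id = 1"
  using assms(2)
proof (induction rule: permutes_descent_induct)
  case id
  show "Poly_Mapping.lookup (C id) id = 1" using assms(1) by (simp add: csm_classes_def)
next
  case (descent w k)
  note k = descent.hyps(1-3)
  have "Poly_Mapping.lookup (C (w \<circ> transpose k (Suc k))) id = 1" by (rule descent.IH)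
  then show "Poly_Mapping.lookup (C w) id = 1"
    unfolding csm_classes_descend[OF assms(1) k]
    using lookup_demazure_lusztig_id[OF csm_classes_supported[OF assms(1)] k(2,3)]
      permutes_comp_adjacent[OF k] by simp
qed

text \<open>Unlike Chevalley's formula for Schubert classes, this sums over all reflections decreasing
  the length, not only over coverings.\<close>

lemma chern_line_csm_classes:
  assumes C: "csm_classes n C" and "w permutes {1..n}"
  shows "chern_line n lam (C w) = (\<Sum>(a, b) \<in> index_pairs n.
           if w b < w a then frag_cmul (lam a - lam b) (C (w \<circ> transpose a b)) else 0)"
  using assms(2)
proof (induction arbitrary: lam rule: permutes_descent_induct)
  case id
  have "chern_line n lam (frag_of id) = 0"
    unfolding chern_line_frag_of by (rule sum.neutral) (auto simp: cover_term_def perm_length_id)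
  moreover have "(\<Sum>(a, b) \<in> index_pairs n.
      if id b < id a then frag_cmul (lam a - lam b) (C (id \<circ> transpose a b)) else 0) = 0"
    by (rule sum.neutral) (auto simp: index_pairs_def)
  moreover have "C id = frag_of id" using C by (simp add: csm_classes_def)
  ultimately show "chern_line n lam (C id) = (\<Sum>(a, b) \<in> index_pairs n.
      if id b < id a then frag_cmul (lam a - lam b) (C (id \<circ> transpose a b)) else 0)"
    by (simp only:)
next
  case (descent w k)
  let ?s = "transpose k (Suc k)" and ?I = "index_pairs n - {(k, Suc k)}"
  let ?v = "w \<circ> ?s"
  let ?F = "\<lambda>(a, b). if w b < w a then frag_cmul (lam a - lam b) (C (w \<circ> transpose a b)) else 0"
  have k: "1 \<le> k" "k < n" and w: "w permutes {1..n}" using descent by auto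
  have v: "?v permutes {1..n}" using permutes_comp_adjacent[OF w k] .
  have ins: "index_pairs n = insert (k, Suc k) ?I" using k by (auto simp: index_pairs_def)
  have T: "demazure_lusztig n k (C (?v \<circ> transpose a b)) = C (w \<circ> transpose (?s a) (?s b))"
    if "(a, b) \<in> index_pairs n" for a b
  proof -
    have "?v \<circ> transpose a b permutes {1..n}"
      using that by (intro permutes_comp_transpose v) (auto simp: index_pairs_def)
    then have "demazure_lusztig n k (C (?v \<circ> transpose a b)) = C (?v \<circ> transpose a b \<circ> ?s)"
      using C k unfolding csm_classes_def by blast
    also have "?v \<circ> transpose a b \<circ> ?s = w \<circ> transpose (?s a) (?s b)"
      by (auto simp: fun_eq_iff transpose_def)
    finally show ?thesis .
  qed
  have IH: "chern_line n mu (C ?v) = (\<Sum>(a, b) \<in> index_pairs n.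
      if ?v b < ?v a then frag_cmul (mu a - mu b) (C (?v \<circ> transpose a b)) else 0)" for mu
    by (rule descent.IH)
  have "demazure_lusztig n k (chern_line n (lam \<circ> ?s) (C ?v)) =
      (\<Sum>(a, b) \<in> index_pairs n. if w (?s b) < w (?s a)
         then frag_cmul (lam (?s a) - lam (?s b)) (C (w \<circ> transpose (?s a) (?s b))) else 0)"
    unfolding IH demazure_lusztig_sum
    by (rule sum.cong) (auto simp: demazure_lusztig_cmul T)
  \<comment> \<open>The term at \<open>(k, Suc k)\<close> vanishes because \<open>w\<close> has a
    descent at \<open>k\<close>.\<close>
  also have "\<dots> = (\<Sum>p \<in> ?I. ?F ((\<lambda>(a, b). (?s a, ?s b)) p))"
    using descent.hyps by (subst ins, subst sum.insert) (auto intro!: sum.cong)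
  also have "\<dots> = sum ?F ?I"
    by (rule sum.reindex_bij_betw[OF bij_betw_transpose_index_pairs[OF k]])
  finally have "chern_line n lam (C w) = sum ?F ?I + frag_cmul (lam k - lam (Suc k)) (C ?v)"
    using csm_classes_descend[OF C w k]
      chern_line_demazure_lusztig[OF csm_classes_supported[OF C v] k, of lam] by simp
  \<comment> \<open>The correction term of the Hecke relation is exactly the missing term at
    \<open>(k, Suc k)\<close>.\<close>
  also have "\<dots> = sum ?F (index_pairs n)"
    using descent.hyps by (subst (2) ins, subst sum.insert) (auto simp: add.commute)
  finally show ?case .
qed

section \<open>Polynomials acting on homology\<close>

lemma poly_mapping_add_induct [case_names zero single add]:
  fixes p :: "'a \<Rightarrow>\<^sub>0 'b::monoid_add"
  assumes "P 0" "\<And>m c. P (Poly_Mapping.single m c)" "\<And>p q. P p \<Longrightarrow> P q \<Longrightarrow> P (p + q)"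
  shows "P p"
proof (induction p rule: update_induct)
  case (update p a b)
  have "Poly_Mapping.update a b p = p + Poly_Mapping.single a b"
    using update.hyps by (auto simp: poly_mapping_eq_iff fun_eq_iff lookup_update lookup_add
        lookup_single in_keys_iff when_def)
  then show ?case using assms update by simp
qed (rule assms(1))

lemma poly_var_mult_single:
  "poly_var i * Poly_Mapping.single m c = Poly_Mapping.single (Poly_Mapping.single i 1 + m) c"
  by (simp add: poly_var_def mult_single)

lemma int_poly_var_induct [case_names const add var]:
  fixes p :: int_poly
  assumes const: "\<And>c. P (Poly_Mapping.single 0 c)" and add: "\<And>p q. P p \<Longrightarrow> P q \<Longrightarrow> P (p + q)"
    and var: "\<And>i p. P p \<Longrightarrow> P (poly_var i * p)"
  shows "P p"
proof (induction p rule: poly_mapping_add_induct)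
  case zero
  then show ?case using const[of 0] by simp
next
  case (single m c)
  \<comment> \<open>The extra factor \<open>m'\<close> makes the claim additive in the exponent
    vector \<open>m\<close>, which the induction requires.\<close>
  have "P (Poly_Mapping.single m' c) \<Longrightarrow> P (Poly_Mapping.single (m + m') c)" for m'
  proof (induction m arbitrary: m' rule: poly_mapping_add_induct)
    case (single i e)
    show ?case
    proof (induction e)
      case (Suc e)
      have "Poly_Mapping.single (Poly_Mapping.single i (Suc e) + m') c =
          poly_var i * Poly_Mapping.single (Poly_Mapping.single i e + m') c"
        by (simp add: poly_var_mult_single add.assoc[symmetric] single_add[symmetric])
      then show ?case using var Suc by simp
    qed (use single in simp)
  next
    case (add p q)
    then show ?case by (simp add: add.assoc)
  qed simp
  from this[of 0] show ?case using const by simp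
qed (rule add)

section \<open>Exchange of two adjacent variables\<close>

lemma inj_map_key_transpose:
  "inj (Poly_Mapping.map_key (transpose k l) :: (nat \<Rightarrow>\<^sub>0 nat) \<Rightarrow> nat \<Rightarrow>\<^sub>0 nat)"
  and map_key_transpose_involutory:
  "Poly_Mapping.map_key (transpose k l) (Poly_Mapping.map_key (transpose k l) m) = m"
proof -
  show invol: "Poly_Mapping.map_key (transpose k l) (Poly_Mapping.map_key (transpose k l) m) = m"
    for m :: "nat \<Rightarrow>\<^sub>0 'b::zero"
    by (simp add: map_key_compose map_key_id[unfolded id_def[symmetric]])
  show "inj (Poly_Mapping.map_key (transpose k l) :: (nat \<Rightarrow>\<^sub>0 nat) \<Rightarrow> nat \<Rightarrow>\<^sub>0 nat)"
    by (rule injI) (metis invol)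
qed

lemma swap_vars_add: "swap_vars k (p + q) = swap_vars k p + swap_vars k q"
  unfolding swap_vars_def by (rule map_key_plus[OF inj_map_key_transpose])

lemma swap_vars_0 [simp]: "swap_vars k 0 = 0"
  unfolding swap_vars_def by (rule map_key_zero[OF inj_map_key_transpose])

lemma swap_vars_single:
  "swap_vars k (Poly_Mapping.single m c) =
     Poly_Mapping.single (Poly_Mapping.map_key (transpose k (Suc k)) m) c"
  unfolding swap_vars_def
  \<comment> \<open>The rule for single keys needs a key in the image of the map; the involution
    writes \<open>m\<close> as one.\<close>
  by (subst map_key_transpose_involutory[symmetric, of m k "Suc k"],
      rule map_key_single[OF inj_map_key_transpose])

lemma swap_vars_poly_var_mult:
  "swap_vars k (poly_var i * p) = poly_var (transpose k (Suc k) i) * swap_vars k p"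
proof (induction p rule: poly_mapping_add_induct)
  case (single m c)
  have "Poly_Mapping.map_key (transpose k (Suc k)) (Poly_Mapping.single i (1::nat)) =
      Poly_Mapping.single (transpose k (Suc k) i) 1"
    using map_key_single[of "transpose k (Suc k)" "transpose k (Suc k) i" "1::nat"] by simp
  then show ?case
    by (simp add: poly_var_mult_single swap_vars_single map_key_plus)
qed (simp_all add: swap_vars_add algebra_simps)

text \<open>The variable \<open>x_i\<close> acts as the first Chern class of weight
  \<open>\<epsilon>_i\<close>. Variables out of range act as the identity, in agreement with
  \<open>eval_dunkl\<close>, which ignores their exponents.\<close>

definition var_op :: "nat \<Rightarrow> nat \<Rightarrow> flag_homology \<Rightarrow> flag_homology" where
  "var_op n i = (if i \<in> {1..n} then chern_line n (\<lambda>j. if j = i then 1 else 0) else id)"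

text \<open>The operator of \<open>x_1\<close> is applied first, matching the leftmost factor in
  \<open>eval_dunkl\<close>, which is the first to act on permutations from the right.\<close>

definition mono_op :: "nat \<Rightarrow> (nat \<Rightarrow>\<^sub>0 nat) \<Rightarrow> flag_homology \<Rightarrow> flag_homology" where
  "mono_op n m = fold (\<lambda>i. var_op n i ^^ Poly_Mapping.lookup m i) [1..<Suc n]"

definition poly_op :: "nat \<Rightarrow> int_poly \<Rightarrow> flag_homology \<Rightarrow> flag_homology" where
  "poly_op n p x = (\<Sum>m \<in> Poly_Mapping.keys p.
     frag_cmul (Poly_Mapping.lookup p m) (mono_op n m x))"

lemma var_op_0 [simp]: "var_op n i 0 = 0"
  and var_op_add: "var_op n i (x + y) = var_op n i x + var_op n i y"
  and var_op_cmul: "var_op n i (frag_cmul c x) = frag_cmul c (var_op n i x)"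
  by (simp_all add: var_op_def chern_line_add chern_line_cmul)

lemma supported_var_op: "supported n x \<Longrightarrow> supported n (var_op n i x)"
  by (simp add: var_op_def supported_chern_line)

lemma var_op_commute: "supported n x \<Longrightarrow> var_op n i (var_op n j x) = var_op n j (var_op n i x)"
  by (simp add: var_op_def chern_line_commute)

lemma funpow_commute_on:
  assumes "\<And>x. P x \<Longrightarrow> P (f x)" "\<And>x. P x \<Longrightarrow> P (g x)" "\<And>x. P x \<Longrightarrow> f (g x) = g (f x)" "P x"
  shows "P ((f ^^ e) x)" and "(f ^^ e) (g x) = g ((f ^^ e) x)"
proof -
  show inv: "P ((f ^^ e) x)" for e by (induction e) (auto simp: assms)
  show "(f ^^ e) (g x) = g ((f ^^ e) x)" by (induction e) (auto simp: assms inv)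
qed

text \<open>The operators commute on elements satisfying \<open>P\<close>, so the additional
  application of \<open>f i\<close> can be carried to the front.\<close>

lemma fold_funpow_add_one:
  assumes "\<And>x i. P x \<Longrightarrow> P (f i x)" "\<And>x i j. P x \<Longrightarrow> f i (f j x) = f j (f i x)" "P x"
    and "distinct xs" "i \<in> set xs"
  shows "fold (\<lambda>j. f j ^^ (e(i := Suc (e i))) j) xs x = fold (\<lambda>j. f j ^^ e j) xs (f i x)"
  using assms(3-5)
proof (induction xs arbitrary: x)
  case (Cons y ys)
  note comm = funpow_commute_on[of P "f y" "f i", OF assms(1) assms(1) assms(2) Cons.prems(1)]
  show ?case
  proof (cases "y = i")
    case True
    then have "fold (\<lambda>j. f j ^^ (e(i := Suc (e i))) j) ys z = fold (\<lambda>j. f j ^^ e j) ys z" for z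
      using Cons.prems(2) by (intro fold_cong) auto
    then show ?thesis using True by (simp add: funpow_swap1)
  next
    case False
    then show ?thesis using Cons comm by simp
  qed
qed simp

lemma poly_op_single: "poly_op n (Poly_Mapping.single m c) x = frag_cmul c (mono_op n m x)"
  by (simp add: poly_op_def)

lemma poly_op_0 [simp]: "poly_op n 0 x = 0"
  by (simp add: poly_op_def)

lemma poly_op_add: "poly_op n (p + q) x = poly_op n p x + poly_op n q x"
  unfolding poly_op_def by (rule setsum_keys_plus_distrib) (simp_all add: frag_cmul_distrib)

lemma poly_op_diff: "poly_op n (p - q) x = poly_op n p x - poly_op n q x"
  using poly_op_add[of n "p - q" q x] by simp

lemma poly_op_const: "poly_op n (Poly_Mapping.single 0 c) x = frag_cmul c x"
proof -
  have "fold (\<lambda>i. var_op n i ^^ 0) xs x = x" for xs by (induction xs) auto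
  then show ?thesis by (simp add: poly_op_single mono_op_def del: upt_Suc)
qed

lemma mono_op_0 [simp]: "mono_op n m 0 = 0"
  and mono_op_add: "mono_op n m (x + y) = mono_op n m x + mono_op n m y"
  and mono_op_cmul: "mono_op n m (frag_cmul c x) = frag_cmul c (mono_op n m x)"
  and supported_mono_op: "supported n x \<Longrightarrow> supported n (mono_op n m x)"
proof -
  have pow: "(var_op n i ^^ e) 0 = 0"
    "(var_op n i ^^ e) (x + y) = (var_op n i ^^ e) x + (var_op n i ^^ e) y"
    "(var_op n i ^^ e) (frag_cmul c x) = frag_cmul c ((var_op n i ^^ e) x)"
    "supported n x \<Longrightarrow> supported n ((var_op n i ^^ e) x)" for i e c x y
    by (induction e) (auto simp: var_op_add var_op_cmul supported_var_op)
  have "fold (\<lambda>i. var_op n i ^^ e i) xs 0 = 0"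
    "fold (\<lambda>i. var_op n i ^^ e i) xs (x + y) =
       fold (\<lambda>i. var_op n i ^^ e i) xs x + fold (\<lambda>i. var_op n i ^^ e i) xs y"
    "fold (\<lambda>i. var_op n i ^^ e i) xs (frag_cmul c x) =
       frag_cmul c (fold (\<lambda>i. var_op n i ^^ e i) xs x)"
    "supported n x \<Longrightarrow> supported n (fold (\<lambda>i. var_op n i ^^ e i) xs x)" for xs e
    by (induction xs arbitrary: x y) (auto simp: pow)
  then show "mono_op n m 0 = 0" "mono_op n m (x + y) = mono_op n m x + mono_op n m y"
    "mono_op n m (frag_cmul c x) = frag_cmul c (mono_op n m x)"
    "supported n x \<Longrightarrow> supported n (mono_op n m x)"
    by (simp_all add: mono_op_def del: upt_Suc)
qed

lemma poly_op_arg_add: "poly_op n p (x + y) = poly_op n p x + poly_op n p y"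
  and poly_op_arg_cmul: "poly_op n p (frag_cmul c x) = frag_cmul c (poly_op n p x)"
  and poly_op_arg_0 [simp]: "poly_op n p 0 = 0"
  by (simp_all add: poly_op_def mono_op_add mono_op_cmul frag_cmul_distrib2 sum.distrib
      frag_cmul_sum mult.commute)

lemma poly_op_arg_diff: "poly_op n p (x - y) = poly_op n p x - poly_op n p y"
  using poly_op_arg_add[of n p "x - y" y] by simp

lemma supported_poly_op: "supported n x \<Longrightarrow> supported n (poly_op n p x)"
  unfolding poly_op_def by (intro supported_sum supported_cmul supported_mono_op)

lemma mono_op_mult_var:
  assumes "supported n x"
  shows "mono_op n (Poly_Mapping.single i 1 + m) x = mono_op n m (var_op n i x)"
proof -
  let ?e = "Poly_Mapping.lookup m"
  have e: "Poly_Mapping.lookup (Poly_Mapping.single i 1 + m) = ?e(i := Suc (?e i))"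
    by (auto simp: fun_eq_iff lookup_add lookup_single when_def)
  show ?thesis
  proof (cases "i \<in> {1..n}")
    case True
    then show ?thesis
      unfolding mono_op_def e using assms
      by (intro fold_funpow_add_one[where P = "supported n"])
        (auto simp: supported_var_op var_op_commute simp del: upt_Suc)
  next
    case False
    then have "mono_op n (Poly_Mapping.single i 1 + m) x = mono_op n m x"
      unfolding mono_op_def e by (intro fold_cong) auto
    then show ?thesis using False by (auto simp: var_op_def)
  qed
qed

lemma poly_op_mult_var:
  assumes "supported n x"
  shows "poly_op n (poly_var i * p) x = poly_op n p (var_op n i x)"
  by (induction p rule: poly_mapping_add_induct)
    (simp_all add: poly_var_mult_single poly_op_single mono_op_mult_var[OF assms] poly_op_add
      distrib_left del: One_nat_def)

lemma poly_op_mult_var_power: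
  "supported n x \<Longrightarrow> poly_op n (poly_var i ^ e * p) x = poly_op n p ((var_op n i ^^ e) x)"
  by (induction e arbitrary: x)
    (simp_all add: mult.assoc poly_op_mult_var supported_var_op funpow_swap1)

section \<open>Leibniz rule for polynomials and divided differences\<close>

lemma var_op_homology_partial:
  assumes x: "supported n x" and k: "1 \<le> k" "k < n"
  shows "var_op n i (homology_partial k x) =
    homology_partial k (var_op n (transpose k (Suc k) i) x) +
    frag_cmul ((if i = k then 1 else 0) - (if i = Suc k then 1 else 0)) x"
proof (cases "i \<in> {1..n}")
  case True
  let ?s = "transpose k (Suc k)"
  have range: "?s i \<in> {1..n}" using True k by (auto simp: transpose_def)
  \<comment> \<open>The Leibniz rule is used for the coordinate weight at \<open>?s i\<close>, whose
    reflection is the one at \<open>i\<close>.\<close>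
  have eps: "(\<lambda>j. if j = ?s i then 1 else 0) \<circ> ?s = (\<lambda>j. if j = i then 1 else (0::int))"
    by (auto simp: fun_eq_iff transpose_def)
  have eq: "(if k = ?s i then 1 else 0) - (if Suc k = ?s i then 1 else (0::int)) =
      - ((if i = k then 1 else 0) - (if i = Suc k then 1 else 0))"
    by (auto simp: transpose_def)
  show ?thesis
    using homology_partial_chern_line[OF x k, of "\<lambda>j. if j = ?s i then 1 else 0"] True range
    unfolding eps eq by (simp add: var_op_def)
next
  case False
  then have "transpose k (Suc k) i = i" using k by (auto simp: transpose_def)
  then show ?thesis using False k by (auto simp: var_op_def)
qed

text \<open>The two variables differ and the polynomial ring has no zero divisors, so any exhibited
  quotient is the one denoted by \<open>THE\<close>.\<close>

lemma divided_difference_eqI: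
  assumes "g * (poly_var k - poly_var (Suc k)) = p - swap_vars k p"
  shows "divided_difference k p = g"
proof -
  have "poly_var k \<noteq> poly_var (Suc k)"
  proof
    assume "poly_var k = poly_var (Suc k)"
    then have "Poly_Mapping.lookup (poly_var k) (Poly_Mapping.single k 1) =
        Poly_Mapping.lookup (poly_var (Suc k)) (Poly_Mapping.single k 1)" by simp
    moreover have "Poly_Mapping.single (Suc k) (1::nat) \<noteq> Poly_Mapping.single k 1"
    proof
      assume "Poly_Mapping.single (Suc k) (1::nat) = Poly_Mapping.single k 1"
      then have "Poly_Mapping.lookup (Poly_Mapping.single (Suc k) (1::nat)) k =
          Poly_Mapping.lookup (Poly_Mapping.single k 1) k" by simp
      then show False by (simp add: lookup_single)
    qed
    ultimately show False by (simp add: poly_var_def lookup_single when_def)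
  qed
  then have "h = g" if "h * (poly_var k - poly_var (Suc k)) = p - swap_vars k p" for h
    using that assms mult_cancel_right[of h "poly_var k - poly_var (Suc k)" g] by auto
  then show ?thesis unfolding divided_difference_def using assms by blast
qed

lemma poly_op_homology_partial:
  assumes "supported n x" and k: "1 \<le> k" "k < n"
  shows "poly_op n p (homology_partial k x) =
    homology_partial k (poly_op n (swap_vars k p) x) + poly_op n (divided_difference k p) x"
proof -
  let ?d = "poly_var k - poly_var (Suc k)" and ?s = "transpose k (Suc k)"
  \<comment> \<open>Existence of the quotient and the operator identity are proved together, by
    induction on products with a variable.\<close>
  have "\<exists>g. g * ?d = p - swap_vars k p \<and>
      (\<forall>x. supported n x \<longrightarrow> poly_op n p (homology_partial k x) =
         homology_partial k (poly_op n (swap_vars k p) x) + poly_op n g x)"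
  proof (induction p rule: int_poly_var_induct)
    case (const c)
    have "Poly_Mapping.map_key ?s (0 :: nat \<Rightarrow>\<^sub>0 nat) = 0" by simp
    then show ?case
      by (intro exI[of _ 0])
        (simp add: swap_vars_single poly_op_const homology_partial_cmul)
  next
    case (add p q)
    then obtain g h where
      "g * ?d = p - swap_vars k p" "h * ?d = q - swap_vars k q"
      "\<And>x. supported n x \<Longrightarrow> poly_op n p (homology_partial k x) =
         homology_partial k (poly_op n (swap_vars k p) x) + poly_op n g x"
      "\<And>x. supported n x \<Longrightarrow> poly_op n q (homology_partial k x) =
         homology_partial k (poly_op n (swap_vars k q) x) + poly_op n h x" by blast
    then show ?case
      by (intro exI[of _ "g + h"])
        (simp add: swap_vars_add poly_op_add homology_partial_add algebra_simps)
  next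
    case (var i p)
    then obtain g where g: "g * ?d = p - swap_vars k p"
      and IH: "\<And>x. supported n x \<Longrightarrow> poly_op n p (homology_partial k x) =
         homology_partial k (poly_op n (swap_vars k p) x) + poly_op n g x" by blast
    define c :: int where "c = (if i = k then 1 else 0) - (if i = Suc k then 1 else 0)"
    \<comment> \<open>\<open>r\<close> is \<open>c\<close> times \<open>p\<close>, the correction in
      the twisted product rule: the divided difference of \<open>x_i p\<close> is
      \<open>x_(?s i)\<close> times that of \<open>p\<close>, plus \<open>c p\<close>.\<close>
    define r where "r = (if i = k then p else if i = Suc k then - p else 0)"
    have r_op: "poly_op n r x = frag_cmul c (poly_op n p x)" for x
      using poly_op_diff[of n 0 p x] by (simp add: r_def c_def)
    have r: "r * ?d = (poly_var i - poly_var (?s i)) * p"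
      by (auto simp: r_def transpose_def algebra_simps)
    have "(poly_var (?s i) * g + r) * ?d =
        poly_var (?s i) * (g * ?d) + r * ?d" by (simp add: algebra_simps)
    also have "\<dots> = poly_var i * p - swap_vars k (poly_var i * p)"
      unfolding g r swap_vars_poly_var_mult by (simp add: algebra_simps)
    finally have "(poly_var (?s i) * g + r) * ?d = poly_var i * p - swap_vars k (poly_var i * p)" .
    moreover have "poly_op n (poly_var i * p) (homology_partial k x) =
        homology_partial k (poly_op n (swap_vars k (poly_var i * p)) x) +
        poly_op n (poly_var (?s i) * g + r) x" if x: "supported n x" for x
      using x by (simp add: poly_op_mult_var supported_homology_partial[OF x k]
          var_op_homology_partial[OF x k] c_def[symmetric] poly_op_arg_add poly_op_arg_cmul IH
          supported_var_op swap_vars_poly_var_mult poly_op_add r_op add.assoc)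
    ultimately show ?case by blast
  qed
  then show ?thesis using divided_difference_eqI assms(1) by metis
qed

text \<open>Taking the coefficient of the point kills the image of
  \<open>homology_partial k\<close>, so the divided difference becomes adjoint to that
  operator.\<close>

lemma lookup_poly_op_divided_difference:
  assumes "supported n x" "1 \<le> k" "k < n"
  shows "Poly_Mapping.lookup (poly_op n (divided_difference k p) x) id =
         Poly_Mapping.lookup (poly_op n p (homology_partial k x)) id"
  using lookup_homology_partial_id[OF supported_poly_op[OF assms(1)] assms(2,3)]
  by (simp add: poly_op_homology_partial[OF assms] lookup_add)

section \<open>Degrees and the staircase monomial\<close>

lemma perm_length_keys_var_op:
  assumes "\<And>u. u \<in> Poly_Mapping.keys x \<Longrightarrow> perm_length u = d"
    and "i \<in> {1..n}" "v \<in> Poly_Mapping.keys (var_op n i x)"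
  shows "perm_length v + 1 = d"
proof -
  have "v \<in> Poly_Mapping.keys (chern_line n (\<lambda>j. if j = i then 1 else 0) x)"
    using assms(2,3) by (simp add: var_op_def)
  then have "v \<in> (\<Union>u \<in> Poly_Mapping.keys x.
      Poly_Mapping.keys (chern_line n (\<lambda>j. if j = i then 1 else 0) (frag_of u)))"
    unfolding chern_line_def frag_extend_of by (rule subsetD[OF keys_frag_extend])
  then obtain u where u: "u \<in> Poly_Mapping.keys x"
    and "v \<in> Poly_Mapping.keys (chern_line n (\<lambda>j. if j = i then 1 else 0) (frag_of u))" by blast
  then have "v \<in> (\<Union>(a, b) \<in> index_pairs n. Poly_Mapping.keys (cover_term a b u))"
    unfolding chern_line_frag_of using keys_sum by (fastforce simp: split_def)
  then show ?thesis using assms(1)[OF u] by (auto simp: cover_term_def split: if_splits)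
qed

lemma perm_length_keys_var_op_funpow:
  assumes "\<And>u. u \<in> Poly_Mapping.keys x \<Longrightarrow> perm_length u = d"
    and "i \<in> {1..n}" "v \<in> Poly_Mapping.keys ((var_op n i ^^ e) x)"
  shows "perm_length v + e = d"
  using assms(3)
proof (induction e arbitrary: v)
  case (Suc e)
  have "perm_length u = d - e" if "u \<in> Poly_Mapping.keys ((var_op n i ^^ e) x)" for u
    using Suc.IH[OF that] by simp
  from perm_length_keys_var_op[OF this assms(2)] Suc.prems show ?case by fastforce
qed (use assms(1) in simp)

lemma perm_length_keys_staircase:
  assumes "\<And>u. u \<in> Poly_Mapping.keys x \<Longrightarrow> perm_length u = d" "supported n x" "1 \<le> a"
    and "v \<in> Poly_Mapping.keys (poly_op n (\<Prod>i = a..<n. poly_var i ^ (n - i)) x)"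
  shows "perm_length v + (\<Sum>i = a..<n. n - i) = d"
  using assms
proof (induction "n - a" arbitrary: a x d)
  case 0
  then have "poly_op n (\<Prod>i = a..<n. poly_var i ^ (n - i)) x = x"
    using poly_op_const[of n 1 x] by simp
  then show ?case using 0 by simp
next
  case (Suc l)
  then have a: "a < n" by simp
  let ?y = "(var_op n a ^^ (n - a)) x"
  have len: "perm_length u = d - (n - a)" and le: "n - a \<le> d" if "u \<in> Poly_Mapping.keys ?y" for u
    using perm_length_keys_var_op_funpow[OF Suc.prems(1) _ that] Suc.prems(3) a by auto
  have y: "supported n ?y"
    using funpow_commute_on(1)[of "supported n" "var_op n a" id x] supported_var_op Suc.prems(2) by auto
  have eq: "poly_op n (\<Prod>i = a..<n. poly_var i ^ (n - i)) x =
      poly_op n (\<Prod>i = Suc a..<n. poly_var i ^ (n - i)) ?y"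
    using a Suc.prems(2) by (simp add: prod.atLeast_Suc_lessThan poly_op_mult_var_power)
  \<comment> \<open>A basis class occurring in \<open>?y\<close> provides
    \<open>n - a \<le> d\<close>, so that the subtraction in \<open>d - (n - a)\<close> is not
    truncated.\<close>
  have "?y \<noteq> 0" using Suc.prems(4) unfolding eq by auto
  then obtain u where "u \<in> Poly_Mapping.keys ?y" by (metis keys_eq_empty ex_in_conv)
  then have "n - a \<le> d" by (rule le)
  moreover have "l = n - Suc a" using Suc.hyps(2) by simp
  then have "perm_length v + (\<Sum>i = Suc a..<n. n - i) = d - (n - a)"
    using Suc.hyps(1)[OF _ len y, of "Suc a"] Suc.prems(4) unfolding eq by simp
  ultimately show ?case using a by (simp add: sum.atLeast_Suc_lessThan)
qed

section \<open>Duality of Schubert polynomials and Schubert classes\<close>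

text \<open>For fixed \<open>i\<close>, the permutations that lead from \<open>longest_perm\<close> restricted to the positions
  \<open>\<ge> i\<close> down to its restriction to the positions \<open>> i\<close>: the value at position \<open>i\<close> descends to \<open>i\<close>
  in unit steps.\<close>

definition chain_perm :: "nat \<Rightarrow> nat \<Rightarrow> nat \<Rightarrow> nat \<Rightarrow> nat" where
  "chain_perm n i r = (\<lambda>j. if j < i \<or> n < j then j else if j = i then n - r
     else if j \<le> i + r then n + i + 1 - j else n + i - j)"

lemma chain_perm_Suc:
  "i + r < n \<Longrightarrow> chain_perm n i (Suc r) = chain_perm n i r \<circ> transpose i (Suc (i + r))"
  by (auto simp: chain_perm_def transpose_def fun_eq_iff)

lemma chain_perm_next: "i < n \<Longrightarrow> chain_perm n i (n - i) = chain_perm n (Suc i) 0"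
  by (auto simp: chain_perm_def fun_eq_iff)

lemma chain_perm_first: "1 \<le> n \<Longrightarrow> chain_perm n 1 0 = longest_perm n"
  by (auto simp: chain_perm_def longest_perm_def fun_eq_iff)

lemma chain_perm_last: "chain_perm n n 0 = id"
  by (auto simp: chain_perm_def fun_eq_iff)

text \<open>Chevalley's formula has a single surviving term. A length-decreasing exchange involving
  position \<open>i\<close> must be with a position from \<open>?l\<close> on, and for any position
  beyond \<open>?l\<close> the value at \<open>?l\<close> lies in between.\<close>

lemma var_op_chain_perm:
  assumes i: "1 \<le> i" "i + r < n" and f: "chain_perm n i r permutes {1..n}"
  shows "var_op n i (frag_of (chain_perm n i r)) = frag_of (chain_perm n i (Suc r))"
proof -
  let ?f = "chain_perm n i r" and ?l = "Suc (i + r)"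
  let ?F = "\<lambda>(a, b). frag_cmul ((if a = i then 1 else 0) - (if b = i then 1 else 0)) (cover_term a b ?f)"
  have step: "cover_term i ?l ?f = frag_of (chain_perm n i (Suc r))"
  proof -
    have "?f ?l < ?f i" using i by (simp add: chain_perm_def)
    moreover have "between (?f \<circ> transpose i ?l) i ?l = {}"
      using i by (auto simp: between_def chain_perm_def transpose_def)
    ultimately show ?thesis
      using perm_length_descent_transpose(2)[OF f, of i ?l] i
      by (simp add: cover_term_def chain_perm_Suc)
  qed
  have other: "?F (a, b) = 0" if ab: "(a, b) \<in> index_pairs n" "(a, b) \<noteq> (i, ?l)" for a b
  proof (cases "a = i \<or> b = i")
    case True
    have bounds: "1 \<le> a" "a < b" "b \<le> n" using ab by (auto simp: index_pairs_def)
    have "cover_term a b ?f = 0"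
    proof (cases "?f a < ?f b")
      case True
      then show ?thesis
        using perm_length_transpose(1)[OF f bounds(2)] by (simp add: cover_term_def)
    next
      case False
      then have less: "?f b < ?f a" using permutes_eq_iff[OF f, of a b] bounds by simp
      then have "a = i" "?l < b"
        using \<open>a = i \<or> b = i\<close> ab bounds i by (auto simp: chain_perm_def split: if_splits)
      then have "?l \<in> between (?f \<circ> transpose a b) a b"
        using bounds i by (auto simp: between_def chain_perm_def transpose_def)
      then show ?thesis
        using perm_length_descent_transpose(2)[OF f bounds less] by (auto simp: cover_term_def)
    qed
    then show ?thesis by simp
  qed auto
  have "(i, ?l) \<in> index_pairs n" using i by (simp add: index_pairs_def)
  then have "sum ?F (index_pairs n) = ?F (i, ?l) + sum ?F (index_pairs n - {(i, ?l)})"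
    by (intro sum.remove) auto
  also have "sum ?F (index_pairs n - {(i, ?l)}) = 0"
  proof (rule sum.neutral, rule ballI)
    fix p assume p: "p \<in> index_pairs n - {(i, ?l)}"
    obtain a b where "p = (a, b)" by force
    then show "?F p = 0" using other[of a b] p by simp
  qed
  finally show ?thesis using i step by (simp add: var_op_def chern_line_frag_of)
qed

lemma var_op_funpow_chain_perm:
  assumes "1 \<le> i" "i + r \<le> n" "chain_perm n i 0 permutes {1..n}"
  shows "chain_perm n i r permutes {1..n} \<and>
    (var_op n i ^^ r) (frag_of (chain_perm n i 0)) = frag_of (chain_perm n i r)"
  using assms(2)
proof (induction r)
  case 0
  have "(var_op n i ^^ 0) (frag_of (chain_perm n i 0)) = frag_of (chain_perm n i 0)"
    unfolding funpow.simps id_apply ..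
  with assms(3) show ?case by (rule conjI)
next
  case (Suc r)
  then have f: "chain_perm n i r permutes {1..n}"
    and pow: "(var_op n i ^^ r) (frag_of (chain_perm n i 0)) = frag_of (chain_perm n i r)"
    and r: "i + r < n" by auto
  have "chain_perm n i (Suc r) permutes {1..n}"
    unfolding chain_perm_Suc[OF r] using assms(1) r by (intro permutes_comp_transpose f) auto
  moreover have "(var_op n i ^^ Suc r) (frag_of (chain_perm n i 0)) = frag_of (chain_perm n i (Suc r))"
    unfolding funpow.simps o_apply pow by (rule var_op_chain_perm[OF assms(1) r f])
  ultimately show ?case by (rule conjI)
qed

text \<open>The factor with exponent \<open>n - i\<close> leads from one
  \<open>chain_perm n i 0\<close> to the next, and the last of these is the identity.\<close>

lemma poly_op_staircase_chain_perm:
  assumes "1 \<le> i" "i \<le> n" "chain_perm n i 0 permutes {1..n}"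
  shows "poly_op n (\<Prod>j = i..<n. poly_var j ^ (n - j)) (frag_of (chain_perm n i 0)) = frag_of id"
  using assms
proof (induction "n - i" arbitrary: i)
  case 0
  then have "i = n" by simp
  then show "poly_op n (\<Prod>j = i..<n. poly_var j ^ (n - j)) (frag_of (chain_perm n i 0)) = frag_of id"
    using poly_op_const[of n 1 "frag_of id"] by (simp add: chain_perm_last)
next
  case (Suc l)
  then have i: "i < n" by simp
  have "chain_perm n (Suc i) 0 permutes {1..n} \<and>
      (var_op n i ^^ (n - i)) (frag_of (chain_perm n i 0)) = frag_of (chain_perm n (Suc i) 0)"
    using var_op_funpow_chain_perm[of i "n - i" n] Suc.prems i by (simp add: chain_perm_next)
  moreover have "poly_op n (\<Prod>j = Suc i..<n. poly_var j ^ (n - j))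
      (frag_of (chain_perm n (Suc i) 0)) = frag_of id"
    using calculation Suc.hyps(1)[of "Suc i"] Suc.hyps(2) i by simp
  ultimately show ?case
    using i supported_frag_of[OF Suc.prems(3)]
    by (simp add: prod.atLeast_Suc_lessThan poly_op_mult_var_power)
qed

lemma lookup_poly_op_staircase:
  assumes "1 \<le> n" "supported n x"
  shows "Poly_Mapping.lookup (poly_op n (\<Prod>j = 1..<n. poly_var j ^ (n - j)) x) id =
    Poly_Mapping.lookup x (longest_perm n)"
  using assms(2)
proof (induction rule: supported_induct)
  case (basis u)
  let ?p = "\<Prod>j = 1..<n. poly_var j ^ (n - j)"
  have top: "poly_op n ?p (frag_of (longest_perm n)) = frag_of id"
    using poly_op_staircase_chain_perm[of 1 n] longest_perm_permutes[of n] assms(1)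
    by (simp add: chain_perm_first[unfolded One_nat_def])
  \<comment> \<open>Applied to \<open>u\<close> and, through \<open>top\<close>, to the longest
    element, this shows that both have the same length, without evaluating the sum.\<close>
  have length: "perm_length w = (\<Sum>j = 1..<n. n - j)"
    if w: "w permutes {1..n}" and "id \<in> Poly_Mapping.keys (poly_op n ?p (frag_of w))" for w
    using perm_length_keys_staircase[OF _ supported_frag_of[OF w], of "perm_length w" 1 id] that(2)
    by (simp add: perm_length_id)
  show "Poly_Mapping.lookup (poly_op n ?p (frag_of u)) id =
      Poly_Mapping.lookup (frag_of u) (longest_perm n)"
  proof (cases "u = longest_perm n")
    case True
    then show ?thesis using top by simp
  next
    case False
    have "id \<notin> Poly_Mapping.keys (poly_op n ?p (frag_of u))"
    proof
      assume "id \<in> Poly_Mapping.keys (poly_op n ?p (frag_of u))"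
      then have "perm_length u = perm_length (longest_perm n)"
        using length[OF basis] length[OF longest_perm_permutes] top by simp
      then show False using False perm_length_longest_perm_unique[OF basis] by simp
    qed
    then show ?thesis using False by (simp add: in_keys_iff lookup_single)
  qed
qed (simp_all add: poly_op_arg_diff lookup_minus)

text \<open>Induction over the recursion of Schubert polynomials: the staircase is the base, and
  adjointness turns each divided difference into \<open>homology_partial k\<close>, which shifts the
  coefficient index.\<close>

lemma lookup_poly_op_schubert:
  assumes "schubert_poly n v p" "1 \<le> n"
  shows "v permutes {1..n}"
    and "supported n x \<Longrightarrow> Poly_Mapping.lookup (poly_op n p x) id = Poly_Mapping.lookup x v"
proof -
  have "v permutes {1..n} \<and> (\<forall>x. supported n x \<longrightarrow>
      Poly_Mapping.lookup (poly_op n p x) id = Poly_Mapping.lookup x v)"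
    using assms(1)
  proof induction
    case longest
    show ?case using lookup_poly_op_staircase[OF assms(2)] longest_perm_permutes by blast
  next
    case (descend w p k)
    then have w: "w permutes {1..n}" and k: "1 \<le> k" "k < n" by auto
    have IH: "Poly_Mapping.lookup (poly_op n p x) id = Poly_Mapping.lookup x w"
      if "supported n x" for x using descend.IH that by blast
    have "w (Suc k) < w k"
      using perm_length_transpose_less_iff(1)[OF w, of k "Suc k"] descend.hyps by simp
    then have "Poly_Mapping.lookup (poly_op n (divided_difference k p) x) id =
        Poly_Mapping.lookup x (w \<circ> transpose k (Suc k))" if "supported n x" for x
      using IH[OF supported_homology_partial[OF that k]] lookup_homology_partial[OF that w k]
        lookup_poly_op_divided_difference[OF that k] by simp
    then show ?case using permutes_comp_adjacent[OF w k] by blast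
  qed
  then show "v permutes {1..n}"
    and "supported n x \<Longrightarrow> Poly_Mapping.lookup (poly_op n p x) id = Poly_Mapping.lookup x v"
    by blast+
qed

text \<open>Ascents lead from \<open>v\<close> up to the longest element; the recursion follows the
  same path downwards.\<close>

lemma schubert_poly_exists:
  assumes "v permutes {1..n}"
  shows "\<exists>p. schubert_poly n v p"
  using assms
proof (induction "perm_length (longest_perm n) - perm_length v" arbitrary: v rule: less_induct)
  case less
  show ?case
  proof (cases "v = longest_perm n")
    case True
    then show ?thesis using schubert_poly.longest by blast
  next
    case False
    with less.prems obtain k where k: "1 \<le> k" "k < n" "v k < v (Suc k)" by (rule exists_ascent)
    let ?u = "v \<circ> transpose k (Suc k)"
    have u: "?u permutes {1..n}" using permutes_comp_adjacent[OF less.prems k(1,2)] .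
    have len: "perm_length ?u = perm_length v + 1"
      using perm_length_adjacent(1)[OF less.prems k(1,2,3)] .
    then have "perm_length (longest_perm n) - perm_length ?u <
        perm_length (longest_perm n) - perm_length v"
      using perm_length_le_longest_perm[OF u] by simp
    from less.hyps[OF this u] obtain p where p: "schubert_poly n ?u p" by blast
    have uv: "?u \<circ> transpose k (Suc k) = v" by (simp add: o_assoc[symmetric])
    have "perm_length (?u \<circ> transpose k (Suc k)) < perm_length ?u" unfolding uv len by simp
    from schubert_poly.descend[OF p k(1,2) this] show ?thesis unfolding uv by blast
  qed
qed

section \<open>The Fomin--Kirillov algebra acting on permutations\<close>

text \<open>The sum of the coefficients of \<open>w \<cdot> u\<close> for a word \<open>u\<close>, in the right representation on
  \<open>\<int>[S\<^sub>n]\<close> described at the beginning.\<close>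

fun descending_walk :: "(nat \<Rightarrow> nat) \<Rightarrow> (nat \<times> nat) list \<Rightarrow> real" where
  "descending_walk w [] = 1"
| "descending_walk w ((i, j) # us) =
     (if w j < w i then descending_walk (w \<circ> transpose i j) us else 0)"

definition walk_sum :: "(nat \<Rightarrow> nat) \<Rightarrow> fk_poly \<Rightarrow> real" where
  "walk_sum w x = (\<Sum>u \<in> Poly_Mapping.keys x.
     Poly_Mapping.lookup x u * descending_walk w (letters u))"

lemma descending_walk_nonneg: "0 \<le> descending_walk w us"
  by (induction w us rule: descending_walk.induct) (auto simp: o_def)

lemma walk_sum_nonneg: "(\<And>u. 0 \<le> Poly_Mapping.lookup x u) \<Longrightarrow> 0 \<le> walk_sum w x"
  unfolding walk_sum_def by (intro sum_nonneg mult_nonneg_nonneg descending_walk_nonneg)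

lemma walk_sum_0 [simp]: "walk_sum w 0 = 0"
  by (simp add: walk_sum_def)

lemma walk_sum_add: "walk_sum w (x + y) = walk_sum w x + walk_sum w y"
  unfolding walk_sum_def by (rule setsum_keys_plus_distrib) (simp_all add: distrib_right)

lemma walk_sum_diff: "walk_sum w (x - y) = walk_sum w x - walk_sum w y"
  using walk_sum_add[of w "x - y" y] by simp

lemma walk_sum_uminus: "walk_sum w (- x) = - walk_sum w x"
  using walk_sum_diff[of w 0 x] by simp

lemma walk_sum_sum: "walk_sum w (sum f I) = (\<Sum>i\<in>I. walk_sum w (f i))"
  by (induction I rule: infinite_finite_induct) (simp_all add: walk_sum_add)

lemma walk_sum_single: "walk_sum w (Poly_Mapping.single u c) = c * descending_walk w (letters u)"
  by (simp add: walk_sum_def)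

lemma walk_sum_scale: "walk_sum w (Poly_Mapping.single 0 c * x) = c * walk_sum w x"
  by (induction x rule: poly_mapping_add_induct)
    (simp_all add: mult_single walk_sum_single distrib_left walk_sum_add)

lemma walk_sum_letter:
  "walk_sum w (Poly_Mapping.single (FK_Word [(i, j)]) 1 * x) =
     (if w j < w i then walk_sum (w \<circ> transpose i j) x else 0)"
  by (induction x rule: poly_mapping_add_induct)
    (simp_all add: mult_single walk_sum_single distrib_left walk_sum_add plus_fk_word_def o_def)

text \<open>The coefficient with which \<open>fk_gen i j\<close> acts when positions
  \<open>i\<close> and \<open>j\<close> hold the values \<open>x\<close> and \<open>y\<close>; the
  negative case accounts for \<open>[ij] = -[ji]\<close>.\<close>

definition step_sign :: "nat \<Rightarrow> nat \<Rightarrow> nat \<Rightarrow> nat \<Rightarrow> real" where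
  "step_sign i j x y = (if i < j \<and> y < x then 1 else if j < i \<and> x < y then - 1 else 0)"

text \<open>The triangle relations on coefficients. Only the relative orders of
  \<open>i, j, k\<close> and of \<open>x, y, z\<close> matter, which leaves finitely many
  cases.\<close>

lemma step_sign_triangle:
  assumes "distinct [i, j, k]" "distinct [x, y, z]"
  shows "step_sign i j x y * step_sign j k x z =
           step_sign j k y z * step_sign i k x y + step_sign i k x z * step_sign i j z y"
    and "step_sign j k y z * step_sign i j x z =
           step_sign i k x z * step_sign j k y x + step_sign i j x y * step_sign i k y z"
proof -
  have ij: "i < j \<or> j < i" and jk: "j < k \<or> k < j" and ik: "i < k \<or> k < i"
    and xy: "x < y \<or> y < x" and yz: "y < z \<or> z < y" and xz: "x < z \<or> z < x"
    using assms by auto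
  show "step_sign i j x y * step_sign j k x z =
      step_sign j k y z * step_sign i k x y + step_sign i k x z * step_sign i j z y"
    using ij jk ik xy yz xz by (elim disjE; simp add: step_sign_def)
  show "step_sign j k y z * step_sign i j x z =
      step_sign i k x z * step_sign j k y x + step_sign i j x y * step_sign i k y z"
    using ij jk ik xy yz xz by (elim disjE; simp add: step_sign_def)
qed

lemma walk_sum_gen:
  "i \<noteq> j \<Longrightarrow> walk_sum w (fk_gen i j * x) = step_sign i j (w i) (w j) * walk_sum (w \<circ> transpose i j) x"
  by (auto simp: fk_gen_def step_sign_def walk_sum_letter walk_sum_uminus transpose_commute[of j i])

lemma walk_sum_gen_gen:
  assumes "i \<noteq> j" "k \<noteq> l"
  shows "walk_sum w (fk_gen i j * fk_gen k l * x) =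
    step_sign i j (w i) (w j) * step_sign k l (w (transpose i j k)) (w (transpose i j l)) *
    walk_sum (w \<circ> transpose i j \<circ> transpose k l) x"
  using assms by (simp add: mult.assoc walk_sum_gen)

text \<open>A repeated exchange would need a descent right after removing it; disjoint exchanges do
  not affect each other; in a triangle relation all three products give the same permutation, so
  only the signs are compared.\<close>

lemma walk_sum_relator:
  assumes "r \<in> fk_relators n" "inj w"
  shows "walk_sum w (r * x) = 0"
proof -
  have neq: "w a \<noteq> w b" if "a \<noteq> b" for a b using assms(2) that by (auto dest: injD)
  from assms(1) show ?thesis
  proof cases
    case (square i j)
    then show ?thesis by (auto simp: mult.assoc walk_sum_gen step_sign_def)
  next
    case (commute i j k l)
    have "w \<circ> transpose i j \<circ> transpose k l = w \<circ> transpose k l \<circ> transpose i j"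
      using commute by (auto simp: fun_eq_iff transpose_def)
    then show ?thesis using commute
      by (simp add: left_diff_distrib mult.assoc walk_sum_diff walk_sum_gen step_sign_def)
  next
    case (triangle1 i j k)
    have "w \<circ> transpose j k \<circ> transpose i k = w \<circ> transpose i j \<circ> transpose j k"
      "w \<circ> transpose i k \<circ> transpose i j = w \<circ> transpose i j \<circ> transpose j k"
      using triangle1 by (auto simp: fun_eq_iff transpose_def)
    then show ?thesis
      using triangle1 step_sign_triangle(1)[of i j k "w i" "w j" "w k"]
        neq[of i j] neq[of j k] neq[of i k]
      by (simp add: left_diff_distrib distrib_right mult.assoc[symmetric] walk_sum_diff
          walk_sum_add walk_sum_gen_gen)
  next
    case (triangle2 i j k)
    have "w \<circ> transpose i k \<circ> transpose j k = w \<circ> transpose j k \<circ> transpose i j"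
      "w \<circ> transpose i j \<circ> transpose i k = w \<circ> transpose j k \<circ> transpose i j"
      using triangle2 by (auto simp: fun_eq_iff transpose_def)
    then show ?thesis
      using triangle2 step_sign_triangle(2)[of i j k "w i" "w j" "w k"]
        neq[of i j] neq[of j k] neq[of i k]
      by (simp add: left_diff_distrib distrib_right mult.assoc[symmetric] walk_sum_diff
          walk_sum_add walk_sum_gen_gen)
  qed
qed

lemma walk_sum_ideal:
  assumes "x \<in> fk_ideal n" "inj w"
  shows "walk_sum w x = 0"
  using assms(1)
proof induction
  case (add x r a b)
  \<comment> \<open>A word on the left either annihilates \<open>w\<close> or replaces it by another
    injective map, hence the claim for all such \<open>w\<close>.\<close>
  have word: "walk_sum w (Poly_Mapping.single (FK_Word us) 1 * (r * b)) = 0" if "inj w" for us w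
    using that
  proof (induction us arbitrary: w)
    case Nil
    then show ?case
      using walk_sum_scale[of w 1 "r * b"] walk_sum_relator[OF add.hyps(2)]
      by (simp add: zero_fk_word_def)
  next
    case (Cons p us)
    obtain i j where p: "p = (i, j)" by force
    have "Poly_Mapping.single (FK_Word (p # us)) (1::real) =
        Poly_Mapping.single (FK_Word [(i, j)]) 1 * Poly_Mapping.single (FK_Word us) 1"
      by (simp add: mult_single plus_fk_word_def p)
    moreover have "inj (w \<circ> transpose i j)"
      using Cons.prems by (intro inj_compose) auto
    then have "walk_sum (w \<circ> transpose i j) (Poly_Mapping.single (FK_Word us) 1 * (r * b)) = 0"
      by (rule Cons.IH)
    ultimately show "walk_sum w (Poly_Mapping.single (FK_Word (p # us)) 1 * (r * b)) = 0"
      by (simp add: mult.assoc walk_sum_letter)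
  qed
  have "walk_sum w (a * (r * b)) = 0"
  proof (induction a rule: poly_mapping_add_induct)
    case (single u c)
    have "Poly_Mapping.single u c =
        Poly_Mapping.single 0 c * Poly_Mapping.single (FK_Word (letters u)) 1"
      by (simp add: mult_single)
    then show ?case using word[OF assms(2), of "letters u"] by (simp add: mult.assoc walk_sum_scale)
  qed (simp_all add: distrib_right walk_sum_add)
  then show ?case using add.IH by (simp add: walk_sum_add mult.assoc)
qed simp

section \<open>Dunkl elements and CSM classes\<close>

lemma sum_index_pairs_coordinate:
  fixes f :: "nat \<Rightarrow> nat \<Rightarrow> real"
  assumes "i \<in> {1..n}"
  shows "(\<Sum>(a, b) \<in> index_pairs n. ((if a = i then 1 else 0) - (if b = i then 1 else 0)) * f a b) =
    (\<Sum>j \<in> {1..n} - {i}. if i < j then f i j else - f j i)"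
proof -
  let ?g = "\<lambda>(a, b). ((if a = i then 1 else 0) - (if b = i then 1 else 0)) * f a b"
  \<comment> \<open>Only the pairs containing \<open>i\<close> contribute. \<open>?h\<close> sorts
    such a pair, and the place of \<open>i\<close> in it decides the sign.\<close>
  let ?h = "\<lambda>j. if i < j then (i, j) else (j, i)"
  have "sum ?g (index_pairs n) = sum ?g (?h ` ({1..n} - {i}))"
  proof (rule sum.mono_neutral_right)
    show "?h ` ({1..n} - {i}) \<subseteq> index_pairs n"
      using assms by (auto simp: index_pairs_def)
    have "?g p = 0" if "p \<in> index_pairs n" "p \<notin> ?h ` ({1..n} - {i})" for p
    proof -
      obtain a b where p: "p = (a, b)" by force
      have "a \<noteq> i"
      proof
        assume "a = i"
        then have "p = ?h b" "b \<in> {1..n} - {i}" using that(1) p by (auto simp: index_pairs_def)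
        then show False using that(2) by blast
      qed
      moreover have "b \<noteq> i"
      proof
        assume "b = i"
        then have "p = ?h a" "a \<in> {1..n} - {i}" using that(1) p by (auto simp: index_pairs_def)
        then show False using that(2) by blast
      qed
      ultimately show ?thesis using p by simp
    qed
    then show "\<forall>p \<in> index_pairs n - ?h ` ({1..n} - {i}). ?g p = 0" by blast
  qed simp
  also have "\<dots> = sum (?g \<circ> ?h) ({1..n} - {i})"
    by (rule sum.reindex) (auto simp: inj_on_def split: if_splits)
  also have "\<dots> = (\<Sum>j \<in> {1..n} - {i}. if i < j then f i j else - f j i)"
    by (rule sum.cong) auto
  finally show ?thesis .
qed

text \<open>\<open>F\<close> computes the walk sums of \<open>x\<close> as coefficients of the
  point. Linearity is included so that \<open>F\<close> can be applied termwise to the expansion of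
  a Chern class acting on \<open>C w\<close>.\<close>

definition walk_operator :: "nat \<Rightarrow> ((nat \<Rightarrow> nat) \<Rightarrow> flag_homology) \<Rightarrow> fk_poly \<Rightarrow>
    (flag_homology \<Rightarrow> flag_homology) \<Rightarrow> bool" where
  "walk_operator n C x F \<longleftrightarrow>
     (\<forall>y z. F (y + z) = F y + F z) \<and> (\<forall>c y. F (frag_cmul c y) = frag_cmul c (F y)) \<and>
     (\<forall>w. w permutes {1..n} \<longrightarrow> walk_sum w x = of_int (Poly_Mapping.lookup (F (C w)) id))"

text \<open>The empty walk has sum 1, which is also the coefficient of the point in every CSM
  class.\<close>

lemma walk_operator_one:
  assumes "csm_classes n C"
  shows "walk_operator n C 1 id"
proof -
  have "letters 0 = []" by (simp add: zero_fk_word_def)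
  then have "walk_sum w 1 = 1" for w using walk_sum_single[of w 0 1] by simp
  then show ?thesis using csm_classes_lookup_id[OF assms] by (simp add: walk_operator_def)
qed

text \<open>Chevalley's formula for the classes \<open>C w\<close> has the same shape as the action of a Dunkl
  element on \<open>w\<close>.\<close>

lemma walk_operator_dunkl:
  assumes C: "csm_classes n C" and x: "walk_operator n C x F" and i: "i \<in> {1..n}"
  shows "walk_operator n C (dunkl n i * x) (F \<circ> var_op n i)"
proof -
  have add: "F (y + z) = F y + F z" and cmul: "F (frag_cmul c y) = frag_cmul c (F y)"
    and walk: "w permutes {1..n} \<Longrightarrow> walk_sum w x = of_int (Poly_Mapping.lookup (F (C w)) id)"
    for y z c w using x by (auto simp: walk_operator_def)
  have zero: "F 0 = 0" using cmul[of 0 0] by simp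
  have sum: "F (sum g I) = (\<Sum>i\<in>I. F (g i))" for g :: "nat \<times> nat \<Rightarrow> flag_homology" and I
    by (induction I rule: infinite_finite_induct) (simp_all add: zero add)
  have "walk_sum w (dunkl n i * x) = of_int (Poly_Mapping.lookup (F (var_op n i (C w))) id)"
    if w: "w permutes {1..n}" for w
  proof -
    let ?f = "\<lambda>a b. if w b < w a then walk_sum (w \<circ> transpose a b) x else 0"
    let ?c = "\<lambda>a b. (if a = i then 1 else 0) - (if b = i then 1 else 0)"
    have chevalley: "var_op n i (C w) = (\<Sum>(a, b) \<in> index_pairs n.
        if w b < w a then frag_cmul (?c a b) (C (w \<circ> transpose a b)) else 0)"
      using i by (simp add: var_op_def chern_line_csm_classes[OF C w])
    have "of_int (Poly_Mapping.lookup (F (var_op n i (C w))) id) =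
        (\<Sum>(a, b) \<in> index_pairs n. ?c a b * ?f a b)"
      unfolding chevalley sum lookup_sum of_int_sum
    proof (rule sum.cong[OF refl])
      fix p assume p: "p \<in> index_pairs n"
      obtain a b where ab: "p = (a, b)" by force
      have "w \<circ> transpose a b permutes {1..n}"
        using p ab by (intro permutes_comp_transpose w) (auto simp: index_pairs_def)
      then show "of_int (Poly_Mapping.lookup (F (case p of (a, b) \<Rightarrow>
          if w b < w a then frag_cmul (?c a b) (C (w \<circ> transpose a b)) else 0)) id) =
          (case p of (a, b) \<Rightarrow> ?c a b * ?f a b)"
        using walk[of "w \<circ> transpose a b"] by (simp add: ab cmul zero)
    qed
    also have "\<dots> = (\<Sum>j \<in> {1..n} - {i}. if i < j then ?f i j else - ?f j i)"
      by (rule sum_index_pairs_coordinate[OF i])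
    also have "\<dots> = walk_sum w (dunkl n i * x)"
      unfolding dunkl_def sum_distrib_right walk_sum_sum
      by (rule sum.cong) (auto simp: walk_sum_gen step_sign_def transpose_commute)
    finally show ?thesis by simp
  qed
  then show ?thesis
    by (simp add: walk_operator_def add cmul var_op_add var_op_cmul)
qed

lemma walk_operator_dunkl_power:
  assumes "csm_classes n C" "walk_operator n C x F" "i \<in> {1..n}"
  shows "walk_operator n C (dunkl n i ^ e * x) (F \<circ> (var_op n i ^^ e))"
proof (induction e)
  case (Suc e)
  \<comment> \<open>The new factor is the leftmost one, so its operator is the first to be
    applied.\<close>
  have eq: "F \<circ> (var_op n i ^^ Suc e) = (F \<circ> (var_op n i ^^ e)) \<circ> var_op n i"
    by (simp add: o_assoc funpow_Suc_right del: funpow.simps)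
  show "walk_operator n C (dunkl n i ^ Suc e * x) (F \<circ> (var_op n i ^^ Suc e))"
    unfolding eq power_Suc mult.assoc
    by (rule walk_operator_dunkl[OF assms(1) _ assms(3)]) (rule Suc)
qed (use assms(2) in simp)

lemma walk_operator_dunkl_monomial:
  assumes "csm_classes n C" "set xs \<subseteq> {1..n}"
  shows "walk_operator n C (prod_list (map (\<lambda>i. dunkl n i ^ e i) xs))
           (fold (\<lambda>i. var_op n i ^^ e i) xs)"
  using assms(2)
  by (induction xs) (auto simp: walk_operator_one[OF assms(1)]
      intro!: walk_operator_dunkl_power[OF assms(1)])

lemma of_int_eq_single: "of_int c = (Poly_Mapping.single 0 (of_int c) :: fk_poly)"
  by (simp add: poly_mapping_eq_iff fun_eq_iff lookup_single lookup_of_int)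

lemma walk_sum_eval_dunkl:
  assumes "csm_classes n C" "w permutes {1..n}"
  shows "walk_sum w (eval_dunkl n p) = of_int (Poly_Mapping.lookup (poly_op n p (C w)) id)"
proof -
  have "walk_sum w (prod_list (map (\<lambda>i. dunkl n i ^ Poly_Mapping.lookup m i) [1..<Suc n])) =
      of_int (Poly_Mapping.lookup (mono_op n m (C w)) id)" for m
  proof -
    have "set [1..<Suc n] \<subseteq> {1..n}" by auto
    from walk_operator_dunkl_monomial[OF assms(1) this, of "Poly_Mapping.lookup m"] assms(2)
    show ?thesis unfolding walk_operator_def mono_op_def by blast
  qed
  then show ?thesis
    unfolding eval_dunkl_def poly_op_def of_int_eq_single walk_sum_sum walk_sum_scale lookup_sum
    by simp
qed

theorem theorem1p1:
  fixes n :: nat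
    and C :: "(nat \<Rightarrow> nat) \<Rightarrow> flag_homology"
    and w v :: "nat \<Rightarrow> nat"
  assumes nonnegativity_conjecture:
      "\<forall>m \<ge> 2. \<forall>u p. u permutes {1..m} \<longrightarrow> schubert_poly m u p \<longrightarrow> fk_nonneg m (eval_dunkl m p)"
    and "n \<ge> 2"
    and "csm_classes n C"
    and "w permutes {1..n}"
    and "v permutes {1..n}"
  shows "Poly_Mapping.lookup (C w) v \<ge> 0"
proof -
  obtain p where p: "schubert_poly n v p" using schubert_poly_exists assms(5) by blast
  then have "fk_nonneg n (eval_dunkl n p)" using nonnegativity_conjecture assms(2,5) by blast
  then obtain y where y: "\<And>u. 0 \<le> Poly_Mapping.lookup y u" "eval_dunkl n p - y \<in> fk_ideal n"
    by (auto simp: fk_nonneg_def fk_eq_def)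
  \<comment> \<open>\<open>walk_sum w\<close> vanishes on the ideal, so the nonnegative
    representative \<open>y\<close> has the same walk sum.\<close>
  have "walk_sum w (eval_dunkl n p) = walk_sum w y"
    using walk_sum_ideal[OF y(2) permutes_inj[OF assms(4)]] by (simp add: walk_sum_diff)
  also have "\<dots> \<ge> 0" using walk_sum_nonneg y(1) .
  finally have "0 \<le> Poly_Mapping.lookup (poly_op n p (C w)) id"
    using walk_sum_eval_dunkl[OF assms(3,4)] by simp
  \<comment> \<open>By duality this coefficient of the point is the coefficient of \<open>v\<close>
    in \<open>C w\<close>.\<close>
  then show ?thesis
    using lookup_poly_op_schubert(2)[OF p _ csm_classes_supported[OF assms(3,4)]] assms(2) by simp
qed

end
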